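(* Let $K$ be a field, let $P_n=\{p_1,\dots,p_n\}$ ($n\ge1$) be a finite poset with $n$ elements such that $p_i\le p_j$ implies $i\le j$, let $G=G(P_n)$, and let $(h_j)_{j\geq 0}$ be the $h$-vector of the vertex cover algebra $A(G)$. For all $0\le j\le n-1$, the component $h_j$ is equal to the number of all linear extensions of all $(n-l)$-element subposets of $P_n$ which, seen as permutations of $[n-l]$, have exactly $j-l$ descents, for all $0\le l\le j$; that is, $$h_j=\sum_{l=0}^{j}\ \sum_{\substack{F\subset[n]\\|F|=n-l}}\#\{\text{linear extensions of }P_n(F)\text{ which, seen as permutations of }[n-l],\text{ have exactly }j-l\text{ descents}\}.$$
   Context: $[m]=\{1,\dots,m\}$. $G(P_n)$ is the bipartite graph on $\{x_1,\dots,x_n\}\cup\{y_1,\dots,y_n\}$ whose edges are all $\{x_i,y_j\}$ with $p_i\le p_j$. For $F\subset[n]$, $P_n(F)$ is the subposet of $P_n$ induced on $\{p_i\mid i\in F\}$. A linear extension of $P_n(F)$, with $|F|=m$, is a listing of its elements in which every element appears after all elements smaller than it in the poset. Relabelling the indices in $F$ by $1,\dots,m$ in increasing order, the listing becomes a permutation (word) $w_1w_2\cdots w_m$ of $[m]$; a descent is a position $k$ with $w_k>w_{k+1}$. Let $S=K[x_1,\dots,x_n,y_1,\dots,y_n]$. A $k$-vertex cover of $G$ ($k\in\mathbb N$, $0\in\mathbb N$) is a vector $c\in\mathbb N^{2n}$, indexed by the vertices, with $c(v)+c(w)\ge k$ for every edge $\{v,w\}$. The vertex cover algebra $A(G)$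 is the subalgebra of $S[t]$ generated over $K$ by all monomials $x_1^{c_1}\cdots x_n^{c_n}y_1^{c_{n+1}}\cdots y_n^{c_{2n}}t^k$ with $c$ a $k$-vertex cover, $k\in\mathbb N$. It is known that $A(G)=\bigoplus_{k\ge0}I_G^kt^k$, where the cover ideal $I_G\subset S$ is minimally generated by the monomials $m_C=\prod_{v\in C}v$, $C$ a minimal vertex cover of $G$, and each such $C$ has exactly $n$ elements. $A(G)$ is a standard graded $K$-algebra by giving degree $1$ to each $x_i$, each $y_j$ and each $m_Ct$. Its Krull dimension is $2n+1$, and its $h$-vector is the coefficient sequence of the polynomial $h(z)$ with $H_{A(G)}(z)=h(z)/(1-z)^{2n+1}$. *)

theory Defs
  imports
    "HOL-Computational_Algebra.Computational_Algebra"
    "HOL-Library.Poly_Mapping"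
begin

section \<open>The polynomial ring $S[t]$ as a vector space\<close>

text \<open>
  Multivariate polynomials over \<open>'k\<close> with variables in \<open>'v\<close> are the monoid algebra of the
  exponent vectors \<open>'v \<Rightarrow>\<^sub>0 nat\<close>, and $S[t]$ is the univariate polynomial ring over it.  The variables
  actually occurring in the algebras below are the vertices of the graph.
\<close>

type_synonym ('v, 'k) mpoly = "('v \<Rightarrow>\<^sub>0 nat) \<Rightarrow>\<^sub>0 'k"

definition scale :: "'k::field \<Rightarrow> ('v, 'k) mpoly poly \<Rightarrow> ('v, 'k) mpoly poly" where
  "scale a f = smult (Poly_Mapping.single 0 a) f"

interpretation S_t: vector_space "scale :: 'k::field \<Rightarrow> ('v, 'k) mpoly poly \<Rightarrow> ('v, 'k) mpoly poly"
proof
  fix a b :: 'k and f g :: "('v, 'k) mpoly poly"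
  show "scale a (f + g) = scale a f + scale a g"
    by (simp add: scale_def smult_add_right)
  show "scale (a + b) f = scale a f + scale b f"
    by (simp add: scale_def single_add smult_add_left)
  show "scale a (scale b f) = scale (a * b) f"
    by (simp add: scale_def mult_single)
  show "scale 1 f = f"
    by (simp add: scale_def)
qed

definition mono_t :: "('v \<Rightarrow>\<^sub>0 nat) \<Rightarrow> nat \<Rightarrow> ('v, 'k::field) mpoly poly" where
  "mono_t c k = monom (Poly_Mapping.single c 1) k"

inductive_set subalgebra_generated ::
    "('v, 'k::field) mpoly poly set \<Rightarrow> ('v, 'k) mpoly poly set"
  for E where
    const: "scale a 1 \<in> subalgebra_generated E"
  | gen: "f \<in> E \<Longrightarrow> f \<in> subalgebra_generated E"
  | add: "f \<in> subalgebra_generated E \<Longrightarrow> g \<in> subalgebra_generated E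
      \<Longrightarrow> f + g \<in> subalgebra_generated E"
  | mult: "f \<in> subalgebra_generated E \<Longrightarrow> g \<in> subalgebra_generated E
      \<Longrightarrow> f * g \<in> subalgebra_generated E"


section \<open>Vertex cover algebras\<close>

type_synonym 'v graph = "'v set \<times> 'v set set"

definition k_vertex_cover :: "'v graph \<Rightarrow> nat \<Rightarrow> ('v \<Rightarrow>\<^sub>0 nat) \<Rightarrow> bool" where
  "k_vertex_cover G k c \<longleftrightarrow> Poly_Mapping.keys c \<subseteq> fst G \<and>
     (\<forall>v w. {v, w} \<in> snd G \<longrightarrow> k \<le> Poly_Mapping.lookup c v + Poly_Mapping.lookup c w)"

definition vertex_cover_algebra :: "'v graph \<Rightarrow> ('v, 'k::field) mpoly poly set" where
  "vertex_cover_algebra G = subalgebra_generated {mono_t c k | c k. k_vertex_cover G k c}"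

definition vertex_cover :: "'v graph \<Rightarrow> 'v set \<Rightarrow> bool" where
  "vertex_cover G C \<longleftrightarrow> C \<subseteq> fst G \<and> (\<forall>e\<in>snd G. C \<inter> e \<noteq> {})"

definition minimal_vertex_cover :: "'v graph \<Rightarrow> 'v set \<Rightarrow> bool" where
  "minimal_vertex_cover G C \<longleftrightarrow> vertex_cover G C \<and> (\<forall>D. vertex_cover G D \<and> D \<subseteq> C \<longrightarrow> D = C)"

definition var :: "'v \<Rightarrow> ('v, 'k::field) mpoly" where
  "var v = Poly_Mapping.single (Poly_Mapping.single v 1) 1"

definition cover_mono :: "'v set \<Rightarrow> ('v, 'k::field) mpoly" where
  "cover_mono C = (\<Prod>v\<in>C. var v)"

text \<open>The elements of $A(G)$ that are given degree 1: the vertices, and $m_C t$ for each minimal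
  vertex cover $C$.\<close>

definition degree_one_generators :: "'v graph \<Rightarrow> ('v, 'k::field) mpoly poly set" where
  "degree_one_generators G =
     {[:var v:] | v. v \<in> fst G} \<union> {monom (cover_mono C) 1 | C. minimal_vertex_cover G C}"


section \<open>Hilbert series and $h$-vector of a standard graded algebra\<close>

text \<open>
  In a standard graded algebra \<open>A\<close> generated by the set \<open>E\<close> of elements of degree 1, the component
  of degree \<open>d\<close> consists of the linear combinations of products of \<open>d\<close> elements of \<open>E\<close>.
\<close>

definition graded_component ::
    "('v, 'k::field) mpoly poly set \<Rightarrow> ('v, 'k) mpoly poly set \<Rightarrow> nat \<Rightarrow> ('v, 'k) mpoly poly set" where
  "graded_component A E d =
     A \<inter> S_t.span {prod_list fs | fs. set fs \<subseteq> E \<and> length fs = d}"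

definition hilbert_series ::
    "('v, 'k::field) mpoly poly set \<Rightarrow> ('v, 'k) mpoly poly set \<Rightarrow> int fps" where
  "hilbert_series A E = Abs_fps (\<lambda>d. int (S_t.dim (graded_component A E d)))"

text \<open>
  For an algebra of Krull dimension \<open>D\<close>, the \<open>h\<close>-vector is the coefficient sequence of
  $h(z) = (1-z)^D H_A(z)$.
\<close>

definition h_vector ::
    "('v, 'k::field) mpoly poly set \<Rightarrow> ('v, 'k) mpoly poly set \<Rightarrow> nat \<Rightarrow> nat \<Rightarrow> int" where
  "h_vector A E D j = fps_nth (hilbert_series A E * (1 - fps_X) ^ D) j"


section \<open>The bipartite graph of a poset, and linear extensions\<close>

datatype vertex = X nat | Y nat

text \<open>The poset is given by its elements \<open>p 1, \<dots>, p n\<close> and its order relation \<open>r\<close>.\<close>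

definition poset_graph :: "nat \<Rightarrow> (nat \<Rightarrow> 'a) \<Rightarrow> 'a rel \<Rightarrow> vertex graph" where
  "poset_graph n p r =
     (X ` {1..n} \<union> Y ` {1..n},
      {{X i, Y j} | i j. i \<in> {1..n} \<and> j \<in> {1..n} \<and> (p i, p j) \<in> r})"

definition linear_extensions :: "'a set \<Rightarrow> 'a rel \<Rightarrow> 'a list set" where
  "linear_extensions Q r = {xs. distinct xs \<and> set xs = Q \<and>
     (\<forall>a<length xs. \<forall>b<length xs. (xs ! a, xs ! b) \<in> r \<and> xs ! a \<noteq> xs ! b \<longrightarrow> a < b)}"

text \<open>
  The word in the letters \<open>1, \<dots>, card F\<close> of a listing of \<open>p ` F\<close>: the letter of \<open>p i\<close> is the rank of
  \<open>i\<close> in \<open>F\<close>.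
\<close>

definition word_of :: "(nat \<Rightarrow> 'a) \<Rightarrow> nat set \<Rightarrow> 'a list \<Rightarrow> nat list" where
  "word_of p F xs = map (\<lambda>q. card {i \<in> F. i \<le> inv_into F p q}) xs"

definition descents :: "nat list \<Rightarrow> nat" where
  "descents w = card {k. Suc k < length w \<and> w ! k > w ! Suc k}"


section \<open>The vertex cover algebra of \<open>G(P\<^sub>n)\<close> is standard graded\<close>

lemma mono_t_mult: "mono_t c k * mono_t d l = mono_t (c + d) (k + l)"
  by (simp add: mono_t_def mult_monom mult_single)

lemma mono_t_0: "mono_t 0 0 = 1"
  by (simp add: mono_t_def)

lemma cover_mono_eq:
  "cover_mono C = Poly_Mapping.single (\<Sum>v\<in>C. Poly_Mapping.single v 1) 1"
  unfolding cover_mono_def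
  by (induction C rule: infinite_finite_induct) (simp_all add: var_def mult_single)

lemma var_t_eq: "[:var v:] = mono_t (Poly_Mapping.single v 1) 0"
  by (simp add: mono_t_def var_def monom_0)

lemma lookup_sum_single:
  assumes "finite C"
  shows "Poly_Mapping.lookup (\<Sum>v\<in>C. Poly_Mapping.single v (1::nat)) w = (if w \<in> C then 1 else 0)"
  using assms
  by (induction C rule: finite_induct) (auto simp: lookup_add lookup_single when_def)

lemma subalgebra_generated_least:
  assumes "E \<subseteq> subalgebra_generated E'"
  shows "subalgebra_generated E \<subseteq> subalgebra_generated E'"
proof
  fix f assume "f \<in> subalgebra_generated E"
  then show "f \<in> subalgebra_generated E'"
    by induction (use assms in \<open>auto intro: subalgebra_generated.intros\<close>)
qed

lemma minimal_vertex_cover_exists: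
  assumes "vertex_cover G C" "finite C"
  shows "\<exists>D\<subseteq>C. minimal_vertex_cover G D"
  using assms(2,1)
proof (induction C rule: finite_psubset_induct)
  case (psubset C)
  show ?case
  proof (cases "minimal_vertex_cover G C")
    case False
    then obtain D where "vertex_cover G D" "D \<subset> C"
      using psubset.prems by (auto simp: minimal_vertex_cover_def)
    then show ?thesis using psubset.IH by (metis psubset_imp_subset subset_trans)
  qed blast
qed

lemma zero_covers_generated:
  fixes G :: "'v graph"
  assumes "Poly_Mapping.keys c \<subseteq> fst G"
  shows "(mono_t c 0 :: ('v, 'k::field) mpoly poly) \<in> subalgebra_generated (degree_one_generators G)"
  using assms
proof (induction "\<Sum>v\<in>Poly_Mapping.keys c. Poly_Mapping.lookup c v" arbitrary: c rule: less_induct)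
  case less
  let ?A = "subalgebra_generated (degree_one_generators G) :: ('v, 'k) mpoly poly set"
  show ?case
  proof (cases "c = 0")
    case True
    then show ?thesis
      using subalgebra_generated.const[of 1 "degree_one_generators G"] by (simp add: mono_t_0)
  next
    case False
    then obtain v where v: "v \<in> Poly_Mapping.keys c" by (metis ex_in_conv keys_eq_empty)
    define d where "d = c - Poly_Mapping.single v 1"
    have c: "c = Poly_Mapping.single v 1 + d"
      using v by (intro poly_mapping_eqI)
        (auto simp: d_def lookup_add lookup_minus lookup_single when_def in_keys_iff)
    have kd: "Poly_Mapping.keys d \<subseteq> Poly_Mapping.keys c"
      by (auto simp: d_def in_keys_iff lookup_minus)
    have "(\<Sum>w\<in>Poly_Mapping.keys d. Poly_Mapping.lookup d w)
        \<le> (\<Sum>w\<in>Poly_Mapping.keys c. Poly_Mapping.lookup d w)"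
      by (intro sum_mono2) (use kd in auto)
    also have "\<dots> < (\<Sum>w\<in>Poly_Mapping.keys c. Poly_Mapping.lookup c w)"
      by (intro sum_strict_mono_ex1)
        (use v in \<open>auto simp: d_def lookup_minus lookup_single when_def in_keys_iff\<close>)
    finally have "mono_t d 0 \<in> ?A"
      using less kd by blast
    moreover have "mono_t (Poly_Mapping.single v 1) 0 \<in> ?A"
      unfolding var_t_eq[symmetric] using v less.prems
      by (intro subalgebra_generated.gen) (auto simp: degree_one_generators_def)
    ultimately show ?thesis
      using subalgebra_generated.mult[of "mono_t (Poly_Mapping.single v 1) 0" _ "mono_t d 0"]
      by (simp add: c mono_t_mult)
  qed
qed

lemma doubleton_poset_graph:
  "{v, w} \<in> snd (poset_graph n p r) \<longleftrightarrow>
     (\<exists>i j. i \<in> {1..n} \<and> j \<in> {1..n} \<and> (p i, p j) \<in> r \<and> (v = X i \<and> w = Y j \<or> v = Y j \<and> w = X i))"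
  by (auto simp: poset_graph_def doubleton_eq_iff)

lemma finite_poset_graph: "finite (fst (poset_graph n p r))"
  by (simp add: poset_graph_def)

lemma k_covers_generated:
  assumes "k_vertex_cover (poset_graph n p r) k c"
  shows "(mono_t c k :: (vertex, 'k::field) mpoly poly)
    \<in> subalgebra_generated (degree_one_generators (poset_graph n p r))"
  using assms
proof (induction k arbitrary: c)
  case 0
  then show ?case by (intro zero_covers_generated) (simp add: k_vertex_cover_def)
next
  case (Suc k)
  let ?G = "poset_graph n p r"
  let ?A = "subalgebra_generated (degree_one_generators ?G) :: (vertex, 'k) mpoly poly set"
  let ?c = "Poly_Mapping.lookup c"
  have keys: "Poly_Mapping.keys c \<subseteq> fst ?G"
    and edge: "\<And>i j. i \<in> {1..n} \<Longrightarrow> j \<in> {1..n} \<Longrightarrow> (p i, p j) \<in> r \<Longrightarrow> Suc k \<le> ?c (X i) + ?c (Y j)"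
    using Suc.prems by (auto simp: k_vertex_cover_def doubleton_poset_graph)
  define C0 where "C0 = {v \<in> fst ?G. case v of X i \<Rightarrow> 1 \<le> ?c v | Y j \<Rightarrow> Suc k \<le> ?c v}"
  have "vertex_cover ?G C0"
    unfolding vertex_cover_def
  proof (intro conjI ballI)
    show "C0 \<subseteq> fst ?G" by (auto simp: C0_def)
    fix e assume "e \<in> snd ?G"
    then obtain i j where ij: "i \<in> {1..n}" "j \<in> {1..n}" "(p i, p j) \<in> r" and e: "e = {X i, Y j}"
      by (auto simp: poset_graph_def)
    have "X i \<in> C0 \<or> Y j \<in> C0"
      using edge[OF ij] ij by (cases "?c (X i)") (auto simp: C0_def poset_graph_def)
    then show "C0 \<inter> e \<noteq> {}" using e by auto
  qed
  moreover have "finite C0" using finite_poset_graph by (rule rev_finite_subset) (auto simp: C0_def)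
  ultimately obtain C where "C \<subseteq> C0" and C: "minimal_vertex_cover ?G C"
    using minimal_vertex_cover_exists by blast
  then have finC: "finite C" using \<open>finite C0\<close> finite_subset by blast
  define u where "u = (\<Sum>v\<in>C. Poly_Mapping.single v (1::nat))"
  have u: "Poly_Mapping.lookup u w = (if w \<in> C then 1 else 0)" for w
    unfolding u_def by (rule lookup_sum_single[OF finC])
  have Cpos: "1 \<le> ?c v" if "v \<in> C" for v
    using that \<open>C \<subseteq> C0\<close> by (cases v) (auto simp: C0_def)
  have CY: "Suc k \<le> ?c (Y j)" if "Y j \<in> C" for j
    using that \<open>C \<subseteq> C0\<close> by (auto simp: C0_def)
  define d where "d = c - u"
  have c: "c = u + d"
    using Cpos by (intro poly_mapping_eqI) (simp add: d_def lookup_add lookup_minus u)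
  have "k_vertex_cover ?G k d"
  proof -
    have "k \<le> Poly_Mapping.lookup d (X i) + Poly_Mapping.lookup d (Y j)"
      if "i \<in> {1..n}" "j \<in> {1..n}" "(p i, p j) \<in> r" for i j
      using edge[OF that] Cpos[of "X i"] CY[of j] by (auto simp: d_def lookup_minus u)
    moreover have "Poly_Mapping.keys d \<subseteq> Poly_Mapping.keys c"
      by (auto simp: d_def in_keys_iff lookup_minus)
    ultimately show ?thesis
      using keys by (auto simp: k_vertex_cover_def doubleton_poset_graph add.commute)
  qed
  then have "mono_t d k \<in> ?A" by (rule Suc.IH)
  moreover have "mono_t u 1 \<in> ?A"
    using C by (intro subalgebra_generated.gen)
      (auto simp: degree_one_generators_def mono_t_def u_def cover_mono_eq)
  ultimately show ?case
    using subalgebra_generated.mult[of "mono_t u 1" _ "mono_t d k"] by (simp add: c mono_t_mult)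
qed

lemma degree_one_generators_subset:
  fixes G :: "'v graph"
  assumes "finite (fst G)"
  shows "(degree_one_generators G :: ('v, 'k::field) mpoly poly set)
    \<subseteq> {mono_t c k | c k. k_vertex_cover G k c}"
proof
  fix f :: "('v, 'k) mpoly poly" assume "f \<in> degree_one_generators G"
  then consider v where "v \<in> fst G" "f = mono_t (Poly_Mapping.single v 1) 0"
    | C where "minimal_vertex_cover G C" "f = monom (cover_mono C) 1"
    by (auto simp: degree_one_generators_def var_t_eq)
  then show "f \<in> {mono_t c k | c k. k_vertex_cover G k c}"
  proof cases
    case 1
    then show ?thesis by (force simp: k_vertex_cover_def)
  next
    case 2
    define u where "u = (\<Sum>v\<in>C. Poly_Mapping.single v (1::nat))"
    have C: "C \<subseteq> fst G" "\<And>e. e \<in> snd G \<Longrightarrow> C \<inter> e \<noteq> {}"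
      using 2(1) by (auto simp: minimal_vertex_cover_def vertex_cover_def)
    have u: "Poly_Mapping.lookup u w = (if w \<in> C then 1 else 0)" for w
      unfolding u_def by (rule lookup_sum_single) (use C assms finite_subset in blast)
    have "k_vertex_cover G 1 u"
      unfolding k_vertex_cover_def
    proof (intro conjI allI impI)
      show "Poly_Mapping.keys u \<subseteq> fst G" using C by (auto simp: in_keys_iff u split: if_splits)
      fix v w assume "{v, w} \<in> snd G"
      from C(2)[OF this] show "1 \<le> Poly_Mapping.lookup u v + Poly_Mapping.lookup u w"
        by (auto simp: u)
    qed
    moreover have "f = mono_t u 1" using 2 by (simp add: mono_t_def u_def cover_mono_eq)
    ultimately show ?thesis by blast
  qed
qed

theorem vertex_cover_algebra_generated:
  "(vertex_cover_algebra (poset_graph n p r) :: (vertex, 'k::field) mpoly poly set) =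
     subalgebra_generated (degree_one_generators (poset_graph n p r))"
  unfolding vertex_cover_algebra_def
proof (intro equalityI subalgebra_generated_least)
  show "{mono_t c k | c k. k_vertex_cover (poset_graph n p r) k c} \<subseteq>
      (subalgebra_generated (degree_one_generators (poset_graph n p r)) :: (vertex, 'k) mpoly poly set)"
    using k_covers_generated by blast
  show "(degree_one_generators (poset_graph n p r) :: (vertex, 'k) mpoly poly set) \<subseteq>
      subalgebra_generated {mono_t c k | c k. k_vertex_cover (poset_graph n p r) k c}"
    by (rule order_trans[OF degree_one_generators_subset[OF finite_poset_graph]])
      (rule subsetI, rule subalgebra_generated.gen)
qed

lemma card_minimal_vertex_cover:
  assumes "partial_order_on P r" "bij_betw p {1..n} P"
    and C: "minimal_vertex_cover (poset_graph n p r) C"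
  shows "card C = n"
proof -
  let ?G = "poset_graph n p r"
  have sub: "C \<subseteq> X ` {1..n} \<union> Y ` {1..n}"
    using C by (simp add: minimal_vertex_cover_def vertex_cover_def poset_graph_def)
  have edge: "X i \<in> C \<or> Y j \<in> C" if "i \<in> {1..n}" "j \<in> {1..n}" "(p i, p j) \<in> r" for i j
  proof -
    have "{X i, Y j} \<in> snd ?G" using that by (auto simp: poset_graph_def)
    then show ?thesis using C by (auto simp: minimal_vertex_cover_def vertex_cover_def)
  qed
  have tight: "\<exists>i j. {X i, Y j} \<inter> C = {v} \<and> i \<in> {1..n} \<and> j \<in> {1..n} \<and> (p i, p j) \<in> r" if "v \<in> C" for v
  proof -
    have "\<not> vertex_cover ?G (C - {v})"
      using C that by (auto simp: minimal_vertex_cover_def)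
    then obtain e where e: "e \<in> snd ?G" "(C - {v}) \<inter> e = {}"
      using C by (auto simp: minimal_vertex_cover_def vertex_cover_def)
    moreover have "C \<inter> e \<noteq> {}"
      using C e by (auto simp: minimal_vertex_cover_def vertex_cover_def)
    ultimately have "e \<inter> C = {v}" by auto
    then show ?thesis using e(1) by (auto simp: poset_graph_def)
  qed
  have not_both: "\<not> (X i \<in> C \<and> Y i \<in> C)" for i
  proof
    assume "X i \<in> C \<and> Y i \<in> C"
    then have xi: "X i \<in> C" and yi: "Y i \<in> C" by auto
    obtain i' j where ij: "{X i', Y j} \<inter> C = {X i}" "j \<in> {1..n}" "(p i', p j) \<in> r"
      using tight[OF xi] by auto
    have "X i \<in> {X i', Y j}" using ij(1) by auto
    moreover have "Y j \<notin> C" using ij(1) by auto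
    ultimately have j: "j \<in> {1..n}" "(p i, p j) \<in> r" "Y j \<notin> C" using ij by auto
    obtain l i' where li: "{X l, Y i'} \<inter> C = {Y i}" "l \<in> {1..n}" "(p l, p i') \<in> r"
      using tight[OF yi] by auto
    have "Y i \<in> {X l, Y i'}" using li(1) by auto
    moreover have "X l \<notin> C" using li(1) by auto
    ultimately have l: "l \<in> {1..n}" "(p l, p i) \<in> r" "X l \<notin> C" using li by auto
    have "(p l, p j) \<in> r"
      using assms(1) j l by (meson partial_order_on_def preorder_on_def transD)
    then show False using edge j l by blast
  qed
  have one: "X i \<in> C \<or> Y i \<in> C" if "i \<in> {1..n}" for i
  proof -
    have "p i \<in> P" using assms(2) that bij_betwE by blast
    then have "(p i, p i) \<in> r"
      using assms(1) by (auto simp: partial_order_on_def preorder_on_def refl_on_def)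
    then show ?thesis using edge that by blast
  qed
  have "bij_betw (\<lambda>v. case v of X i \<Rightarrow> i | Y i \<Rightarrow> i) C {1..n}"
    unfolding bij_betw_def
  proof
    show "inj_on (\<lambda>v. case v of X i \<Rightarrow> i | Y i \<Rightarrow> i) C"
      using not_both by (auto simp: inj_on_def split: vertex.splits)
    show "(\<lambda>v. case v of X i \<Rightarrow> i | Y i \<Rightarrow> i) ` C = {1..n}"
    proof (intro equalityI subsetI)
      fix i assume "i \<in> {1..n}"
      from one[OF this] show "i \<in> (\<lambda>v. case v of X i \<Rightarrow> i | Y i \<Rightarrow> i) ` C"
        by (elim disjE) (rule image_eqI[rotated], assumption, simp)+
    qed (use sub in auto)
  qed
  then show ?thesis using bij_betw_same_card by fastforce
qed

text \<open>
  The components of different degrees are independent: give \<open>x\<^sub>i\<close> and \<open>y\<^sub>j\<close> weight 1 and \<open>t\<close> weight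
  \<open>1 - n\<close>; since minimal vertex covers have \<open>n\<close> elements, all generators have weight 1.
\<close>

definition wt :: "nat \<Rightarrow> (vertex \<Rightarrow>\<^sub>0 nat) \<Rightarrow> nat \<Rightarrow> int" where
  "wt n c k = (\<Sum>v\<in>X ` {1..n} \<union> Y ` {1..n}. int (Poly_Mapping.lookup c v)) + (1 - int n) * int k"

lemma wt_add: "wt n (c + d) (k + l) = wt n c k + wt n d l"
  by (simp add: wt_def lookup_add sum.distrib algebra_simps)

lemma generator_wt:
  assumes "partial_order_on P r" "bij_betw p {1..n} P"
    and "f \<in> degree_one_generators (poset_graph n p r)"
  shows "\<exists>c k. f = mono_t c k \<and> wt n c k = 1"
proof -
  from assms(3) consider v where "v \<in> X ` {1..n} \<union> Y ` {1..n}" "f = mono_t (Poly_Mapping.single v 1) 0"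
    | C where "minimal_vertex_cover (poset_graph n p r) C" "f = monom (cover_mono C) 1"
    by (auto simp: degree_one_generators_def var_t_eq poset_graph_def)
  then show ?thesis
  proof cases
    case 1
    have "wt n (Poly_Mapping.single v 1) 0
        = (\<Sum>w\<in>X ` {1..n} \<union> Y ` {1..n}. if w = v then 1 else 0)"
      unfolding wt_def of_nat_0 mult_zero_right add_0_right
      by (rule sum.cong) (simp_all add: lookup_single when_def)
    also have "\<dots> = 1" using 1(1) by (subst sum.delta) auto
    finally show ?thesis using 1(2) by blast
  next
    case 2
    have sub: "C \<subseteq> X ` {1..n} \<union> Y ` {1..n}"
      using 2 by (simp add: minimal_vertex_cover_def vertex_cover_def poset_graph_def)
    have fin: "finite C" using sub finite_subset by blast
    have "wt n (\<Sum>v\<in>C. Poly_Mapping.single v 1) 1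
        = (\<Sum>w\<in>X ` {1..n} \<union> Y ` {1..n}. if w \<in> C then 1 else 0) + (1 - int n)"
      unfolding wt_def lookup_sum_single[OF fin] by (simp add: if_distrib cong: if_cong)
    also have "(\<Sum>w\<in>X ` {1..n} \<union> Y ` {1..n}. if w \<in> C then 1 else (0::int)) = int (card C)"
      using sub by (simp add: sum.If_cases Int_absorb1 Int_absorb2)
    also have "card C = n" by (rule card_minimal_vertex_cover[OF assms(1,2) 2(1)])
    finally show ?thesis
      using 2(2) by (intro exI[of _ "\<Sum>v\<in>C. Poly_Mapping.single v 1"] exI[of _ 1])
        (simp add: mono_t_def cover_mono_eq)
  qed
qed

lemma product_wt:
  assumes "partial_order_on P r" "bij_betw p {1..n} P"
    and "set fs \<subseteq> degree_one_generators (poset_graph n p r)"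
  shows "\<exists>c k. prod_list fs = mono_t c k \<and> wt n c k = int (length fs)"
  using assms(3)
proof (induction fs)
  case Nil
  have "prod_list [] = mono_t 0 0 \<and> wt n 0 0 = int (length [])" by (simp add: mono_t_0 wt_def)
  then show ?case by blast
next
  case (Cons f fs)
  then obtain c k where "prod_list fs = mono_t c k" "wt n c k = int (length fs)" by auto
  moreover obtain d l where "f = mono_t d l" "wt n d l = 1"
    using Cons.prems generator_wt[OF assms(1,2)] by (metis list.set_intros(1) subsetD)
  ultimately have "prod_list (f # fs) = mono_t (d + c) (l + k) \<and>
      wt n (d + c) (l + k) = int (length (f # fs))"
    by (simp add: mono_t_mult wt_add)
  then show ?case by blast
qed

lemma graded_component_wt:
  assumes "partial_order_on P r" "bij_betw p {1..n} P"
    and f: "f \<in> graded_component A (degree_one_generators (poset_graph n p r)) d"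
    and nz: "Poly_Mapping.lookup (coeff f k) c \<noteq> 0"
  shows "wt n c k = int d"
proof -
  let ?B = "{prod_list fs | fs. set fs \<subseteq> degree_one_generators (poset_graph n p r) \<and> length fs = d}"
  have "f \<in> S_t.span ?B" using f by (simp add: graded_component_def)
  then have "\<forall>k c. Poly_Mapping.lookup (coeff f k) c \<noteq> 0 \<longrightarrow> wt n c k = int d"
  proof (induction rule: S_t.span_induct_alt)
    case base
    show ?case by simp
  next
    case (step a b g)
    then obtain c' k' where b: "b = mono_t c' k'" and w: "wt n c' k' = int d"
      using product_wt[OF assms(1,2)] by blast
    have "Poly_Mapping.lookup (coeff (scale a b) k) c = 0" if "(c, k) \<noteq> (c', k')" for c k
      using that by (auto simp: b scale_def mono_t_def smult_monom mult_single lookup_single when_def)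
    then show ?case using step.IH w by (force simp: lookup_add)
  qed
  then show ?thesis using nz by blast
qed

theorem graded_components_independent:
  assumes "partial_order_on P r" "bij_betw p {1..n} P" "finite D"
    and f: "\<And>d. d \<in> D \<Longrightarrow>
      f d \<in> graded_component (vertex_cover_algebra (poset_graph n p r))
              (degree_one_generators (poset_graph n p r)) d"
    and sum: "(\<Sum>d\<in>D. f d) = 0" and d: "d \<in> D"
  shows "f d = 0"
proof (rule ccontr)
  assume "f d \<noteq> 0"
  then obtain k c where nz: "Poly_Mapping.lookup (coeff (f d) k) c \<noteq> 0"
    by (metis leading_coeff_0_iff lookup_zero poly_mapping_eqI)
  have w: "wt n c k = int d" using graded_component_wt[OF assms(1,2) f[OF d] nz] .
  have "0 = (\<Sum>e\<in>D. Poly_Mapping.lookup (coeff (f e) k) c)"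
    using arg_cong[OF sum, of "\<lambda>g. Poly_Mapping.lookup (coeff g k) c"]
    by (simp add: coeff_sum lookup_sum)
  also have "\<dots> = (\<Sum>e\<in>D. if e = d then Poly_Mapping.lookup (coeff (f d) k) c else 0)"
    by (rule sum.cong) (use graded_component_wt[OF assms(1,2) f] w in force)+
  also have "\<dots> = Poly_Mapping.lookup (coeff (f d) k) c" using d \<open>finite D\<close> by simp
  finally show False using nz by simp
qed

end

theory Submission
  imports Defs "HOL-Library.Product_Lexorder"
begin

text \<open>
  Weight the monomial of a \<open>k\<close>-cover \<open>c\<close> by its degree; since
  minimal covers have \<open>n\<close> elements, this is \<open>k\<close> plus the sum of the excesses
  \<open>c(x\<^sub>i) + c(y\<^sub>i) - k\<close>.  A \<open>k\<close>-cover determines a smallest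
  order-reversing map \<open>f\<close> into \<open>{0..k}\<close> with \<open>c(x\<^sub>i) \<ge> f i\<close> and
  \<open>c(y\<^sub>i) \<ge> k - f i\<close>, and the covers with a given \<open>f\<close> arise by adding arbitrary
  amounts at all \<open>x\<^sub>i\<close> and at those \<open>y\<^sub>i\<close> for which \<open>i\<close> is not a strict point,
  where \<open>i\<close> is strict if \<open>f i\<close> exceeds 0 and all values of \<open>f\<close> above \<open>i\<close>.
  Writing \<open>T(f)\<close> for the set of strict points, this gives
  \[ (1-z)^{2n} H(z) = \sum_k z^k \sum_f (1-z)^{|T(f)|}, \qquad
     (1-z)^{|T(f)|} = \sum_{F \supseteq T(f)} z^{n-|F|} (1-z)^{|F|}. \]
  For fixed \<open>F\<close>, restriction to \<open>F\<close> is a bijection from the maps \<open>f\<close> with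
  \<open>T(f) \<subseteq> F\<close> to the order-reversing maps on \<open>F\<close>, and Stanley's theory of
  \<open>P\<close>-partitions counts the latter by linear extensions and descents.
\<close>

section \<open>Graded components and vertex covers\<close>

lemma lookup_coeff_mono_t:
  "Poly_Mapping.lookup (coeff (mono_t c k :: ('v, 'k::field) mpoly poly) l) d =
    (if k = l \<and> c = d then 1 else 0)"
  by (simp add: mono_t_def lookup_single when_def)

lemma mono_t_eq_iff:
  "(mono_t c k :: ('v, 'k::field) mpoly poly) = mono_t d l \<longleftrightarrow> c = d \<and> k = l"
proof
  assume "(mono_t c k :: ('v, 'k) mpoly poly) = mono_t d l"
  then have "Poly_Mapping.lookup (coeff (mono_t c k :: ('v, 'k) mpoly poly) l) d =
      Poly_Mapping.lookup (coeff (mono_t d l :: ('v, 'k) mpoly poly) l) d"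
    by simp
  then show "c = d \<and> k = l"
    by (simp add: lookup_coeff_mono_t split: if_splits)
qed simp

text \<open>Scaling and adding never create new monomials. This yields both the linear independence
  of monomials and a way to recognise a monomial in a span as one of the spanning elements.\<close>

lemma mono_t_mem_of_span:
  assumes "f \<in> S_t.span B" and B: "B \<subseteq> {mono_t c k | c k. True}"
    and "Poly_Mapping.lookup (coeff f k) c \<noteq> 0"
  shows "(mono_t c k :: ('v, 'k::field) mpoly poly) \<in> B"
proof -
  from assms(1) have
    "\<forall>k c. Poly_Mapping.lookup (coeff f k) c \<noteq> 0 \<longrightarrow> (mono_t c k :: ('v, 'k::field) mpoly poly) \<in> B"
  proof (induction rule: S_t.span_induct_alt)
    case base
    show ?case by simp
  next
    case (step a b g)
    then obtain c' k' where b: "b = mono_t c' k'"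
      using B by blast
    have "Poly_Mapping.lookup (coeff (scale a b) k) c = 0" if "(c, k) \<noteq> (c', k')" for c k
      using that by (auto simp: b scale_def mono_t_def smult_monom mult_single lookup_single when_def)
    then show ?case using step b by (force simp: lookup_add)
  qed
  then show ?thesis using assms(3) by blast
qed

lemma independent_mono_t:
  assumes B: "(B :: ('v, 'k::field) mpoly poly set) \<subseteq> {mono_t c k | c k. True}"
  shows "S_t.independent B"
  unfolding S_t.dependent_def
proof
  assume "\<exists>a\<in>B. a \<in> S_t.span (B - {a})"
  then obtain a where a: "a \<in> B" "a \<in> S_t.span (B - {a})" by blast
  then obtain c k where ck: "a = mono_t c k" using B by blast
  have "mono_t c k \<in> B - {a}"
    by (rule mono_t_mem_of_span[OF a(2)]) (use B in \<open>auto simp: ck lookup_coeff_mono_t\<close>)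
  then show False using ck by simp
qed

text \<open>The products of generators contain 1 and are closed under multiplication, so by
  bilinearity their span is closed under multiplication too. Bilinearity takes two inductions over
  spans, one for each factor.\<close>

lemma subalgebra_generated_subset_span:
  fixes E :: "('v, 'k::field) mpoly poly set"
  assumes "f \<in> subalgebra_generated E"
  shows "f \<in> S_t.span {prod_list fs | fs. set fs \<subseteq> E}" (is "f \<in> S_t.span ?B")
  using assms
proof induction
  case (const a)
  have "1 \<in> ?B" by (rule CollectI, rule exI[of _ "[]"]) simp
  then show ?case by (intro S_t.span_scale S_t.span_base)
next
  case (gen f)
  then have "f \<in> ?B" by (intro CollectI exI[of _ "[f]"]) simp
  then show ?case by (rule S_t.span_base)
next
  case (add f g)
  then show ?case by (intro S_t.span_add)
next
  case (mult f g)
  have base: "a * g \<in> S_t.span ?B" if "a \<in> ?B" for a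
    using mult.IH(2)
  proof (induction rule: S_t.span_induct_alt)
    case base
    then show ?case by (simp add: S_t.span_zero)
  next
    case (step x b h)
    from \<open>a \<in> ?B\<close> \<open>b \<in> ?B\<close> obtain fs gs where
      "a = prod_list fs" "b = prod_list gs" "set fs \<subseteq> E" "set gs \<subseteq> E" by blast
    then have "a * b \<in> ?B" by (intro CollectI exI[of _ "fs @ gs"]) simp
    then have "scale x (a * b) + a * h \<in> S_t.span ?B"
      using step.IH by (intro S_t.span_add S_t.span_scale[OF S_t.span_base])
    moreover have "scale x (a * b) + a * h = a * (scale x b + h)"
      by (simp add: scale_def algebra_simps)
    ultimately show ?case by simp
  qed
  from mult.IH(1) show ?case
  proof (induction rule: S_t.span_induct_alt)
    case base
    then show ?case by (simp add: S_t.span_zero)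
  next
    case (step x b h)
    then have "scale x (b * g) + h * g \<in> S_t.span ?B"
      using base by (intro S_t.span_add S_t.span_scale) auto
    moreover have "scale x (b * g) + h * g = (scale x b + h) * g"
      by (simp add: scale_def algebra_simps)
    ultimately show ?case by simp
  qed
qed

lemma span_subset_subalgebra_generated:
  assumes "B \<subseteq> subalgebra_generated E"
  shows "S_t.span B \<subseteq> subalgebra_generated E"
proof
  fix f assume "f \<in> S_t.span B"
  then show "f \<in> subalgebra_generated E"
  proof (induction rule: S_t.span_induct_alt)
    case base
    then show ?case using subalgebra_generated.const[of 0 E] by (simp add: scale_def)
  next
    case (step a b g)
    then have "scale a 1 * b + g \<in> subalgebra_generated E"
      using assms by (blast intro: subalgebra_generated.const subalgebra_generated.add
          subalgebra_generated.mult)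
    then show ?case by (simp add: scale_def)
  qed
qed

lemma prod_list_in_subalgebra_generated:
  assumes "set fs \<subseteq> E"
  shows "prod_list fs \<in> subalgebra_generated E"
  using assms
proof (induction fs)
  case Nil
  then show ?case using subalgebra_generated.const[of 1 E] by simp
qed (auto intro: subalgebra_generated.intros)

section \<open>Products of generators as monomials of covers\<close>

lemma k_vertex_cover_add:
  assumes "k_vertex_cover G k c" "k_vertex_cover G l d"
  shows "k_vertex_cover G (k + l) (c + d)"
proof -
  have "Poly_Mapping.keys (c + d) \<subseteq> fst G"
    using assms Poly_Mapping.keys_add[of c d] by (auto simp: k_vertex_cover_def)
  moreover have "k + l \<le> Poly_Mapping.lookup (c + d) v + Poly_Mapping.lookup (c + d) w"
    if "{v, w} \<in> snd G" for v w
  proof -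
    have "k \<le> Poly_Mapping.lookup c v + Poly_Mapping.lookup c w"
      "l \<le> Poly_Mapping.lookup d v + Poly_Mapping.lookup d w"
      using assms that by (auto simp: k_vertex_cover_def)
    then show ?thesis by (simp add: lookup_add)
  qed
  ultimately show ?thesis by (simp add: k_vertex_cover_def)
qed

lemma prod_list_generators_cover:
  fixes G :: "'v graph"
  assumes "finite (fst G)" "set fs \<subseteq> (degree_one_generators G :: ('v, 'k::field) mpoly poly set)"
  shows "\<exists>c k. prod_list fs = mono_t c k \<and> k_vertex_cover G k c"
  using assms(2)
proof (induction fs)
  case Nil
  have "prod_list [] = (mono_t 0 0 :: ('v, 'k) mpoly poly) \<and> k_vertex_cover G 0 0"
    by (simp add: mono_t_0 k_vertex_cover_def)
  then show ?case by blast
next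
  case (Cons f fs)
  then obtain c k where ck: "prod_list fs = mono_t c k" "k_vertex_cover G k c" by auto
  obtain d l where dl: "f = mono_t d l" "k_vertex_cover G l d"
    using degree_one_generators_subset[OF assms(1), where ?'k = 'k] Cons.prems by auto
  have "prod_list (f # fs) = mono_t (d + c) (l + k)"
    by (simp add: ck dl mono_t_mult)
  then show ?case using k_vertex_cover_add[OF dl(2) ck(2)] by blast
qed

text \<open>For the harder inclusion, the monomial of a cover lies in the subalgebra, hence in the
  span of all products of generators. As these are monomials, it must itself be one of them, and its
  weight fixes the number of factors.\<close>

lemma products_of_generators:
  fixes P :: "'a set"
  assumes "partial_order_on P r" "bij_betw p {1..n} P"
  defines "G \<equiv> poset_graph n p r"
  shows "{prod_list fs | fs. set fs \<subseteq> (degree_one_generators G :: (vertex, 'k::field) mpoly poly set)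
      \<and> length fs = d} =
    (\<lambda>(c, k). mono_t c k) ` {(c, k). k_vertex_cover G k c \<and> wt n c k = int d}" (is "?L = ?R")
proof (intro equalityI subsetI)
  fix f :: "(vertex, 'k) mpoly poly" assume "f \<in> ?L"
  then obtain fs where fs: "f = prod_list fs" "set fs \<subseteq> degree_one_generators G" "length fs = d"
    by blast
  obtain c k where "f = mono_t c k" "k_vertex_cover G k c"
    using prod_list_generators_cover[of G fs] fs finite_poset_graph unfolding G_def by blast
  moreover have "wt n c k = int d"
    using product_wt[OF assms(1,2) fs(2)[unfolded G_def]] fs calculation by (auto simp: mono_t_eq_iff)
  ultimately show "f \<in> ?R" by force
next
  fix f :: "(vertex, 'k) mpoly poly" assume "f \<in> ?R"
  then obtain c k where ck: "f = mono_t c k" "k_vertex_cover G k c" "wt n c k = int d" by auto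
  let ?B = "{prod_list fs | fs. set fs \<subseteq> (degree_one_generators G :: (vertex, 'k::field) mpoly poly set)}"
  have "?B \<subseteq> {mono_t c k | c k. True}"
    using prod_list_generators_cover[of G] finite_poset_graph unfolding G_def by blast
  moreover have "f \<in> S_t.span ?B"
    using k_covers_generated[OF ck(2)[unfolded G_def], where ?'k = 'k]
    by (intro subalgebra_generated_subset_span) (simp add: ck G_def)
  ultimately have "f \<in> ?B"
    using mono_t_mem_of_span[of f ?B k c] by (simp add: ck lookup_coeff_mono_t)
  then obtain fs where fs: "f = prod_list fs" "set fs \<subseteq> degree_one_generators G" by blast
  have "length fs = d"
    using product_wt[OF assms(1,2) fs(2)[unfolded G_def]] fs ck by (auto simp: mono_t_eq_iff)
  then show "f \<in> ?L" using fs by blast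
qed

lemma dim_graded_component:
  fixes P :: "'a set"
  assumes "partial_order_on P r" "bij_betw p {1..n} P"
  defines "G \<equiv> poset_graph n p r"
  shows "S_t.dim (graded_component (vertex_cover_algebra G)
      (degree_one_generators G :: (vertex, 'k::field) mpoly poly set) d) =
    card {(c, k). k_vertex_cover G k c \<and> wt n c k = int d}"
proof -
  let ?E = "degree_one_generators G :: (vertex, 'k) mpoly poly set"
  let ?B = "{prod_list fs | fs. set fs \<subseteq> ?E \<and> length fs = d}"
  have "?B \<subseteq> vertex_cover_algebra G"
    unfolding G_def vertex_cover_algebra_generated using prod_list_in_subalgebra_generated by blast
  then have "S_t.span ?B \<subseteq> vertex_cover_algebra G"
    unfolding vertex_cover_algebra_def by (rule span_subset_subalgebra_generated)
  then have "graded_component (vertex_cover_algebra G) ?E d = S_t.span ?B"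
    by (auto simp: graded_component_def)
  moreover have indep: "S_t.independent ?B"
    using products_of_generators[OF assms(1,2), where ?'k = 'k]
    by (intro independent_mono_t) (auto simp: G_def)
  ultimately have "S_t.dim (graded_component (vertex_cover_algebra G) ?E d) = card ?B"
    using S_t.dim_span_eq_card_independent[OF indep] by simp
  also have "\<dots> = card {(c, k). k_vertex_cover G k c \<and> wt n c k = int d}"
    unfolding G_def products_of_generators[OF assms(1,2)]
    by (intro card_image) (auto simp: inj_on_def mono_t_eq_iff)
  finally show ?thesis .
qed


section \<open>Generating functions\<close>

lemma partial_sums_fps:
  fixes a :: "nat \<Rightarrow> 'b::comm_ring_1"
  shows "Abs_fps (\<lambda>n. \<Sum>i\<le>n. a i) * (1 - fps_X) = Abs_fps a"
proof (rule fps_ext)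
  fix n
  show "fps_nth (Abs_fps (\<lambda>n. \<Sum>i\<le>n. a i) * (1 - fps_X)) n = fps_nth (Abs_fps a) n"
    by (cases n) (simp_all add: algebra_simps)
qed

text \<open>The formal power series $\sum_k z^k f_k(z)$.\<close>

definition shifted_sum :: "(nat \<Rightarrow> 'b::comm_ring_1 fps) \<Rightarrow> 'b fps" where
  "shifted_sum f = Abs_fps (\<lambda>d. \<Sum>k\<le>d. fps_nth (f k) (d - k))"

text \<open>Terms with \<open>k > d\<close> do not reach the coefficient of \<open>z^d\<close>, so
  any truncation from \<open>d\<close> on gives it. Identities about the infinite sum thus become
  identities about finite ones.\<close>

lemma shifted_sum_nth:
  assumes "d \<le> m"
  shows "fps_nth (shifted_sum f) d = fps_nth (\<Sum>k\<le>m. fps_X ^ k * f k) d"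
proof -
  have "fps_nth (\<Sum>k\<le>m. fps_X ^ k * f k) d = (\<Sum>k\<le>m. if k \<le> d then fps_nth (f k) (d - k) else 0)"
    unfolding fps_sum_nth by (rule sum.cong) (auto simp: fps_X_power_mult_nth)
  also have "\<dots> = (\<Sum>k\<le>d. fps_nth (f k) (d - k))"
    using assms by (intro sum.mono_neutral_cong_right) auto
  finally show ?thesis by (simp add: shifted_sum_def)
qed

lemma shifted_sum_mult: "shifted_sum f * g = shifted_sum (\<lambda>k. f k * g)"
proof (rule fps_ext)
  fix d
  have "fps_nth (shifted_sum f * g) d = fps_nth ((\<Sum>k\<le>d. fps_X ^ k * f k) * g) d"
    unfolding fps_mult_nth by (rule sum.cong) (simp_all add: shifted_sum_nth)
  also have "\<dots> = fps_nth (shifted_sum (\<lambda>k. f k * g)) d"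
    by (simp add: shifted_sum_nth[of d d] sum_distrib_right mult.assoc)
  finally show "fps_nth (shifted_sum f * g) d = fps_nth (shifted_sum (\<lambda>k. f k * g)) d" .
qed

lemma shifted_sum_sum: "shifted_sum (\<lambda>k. \<Sum>x\<in>A. f x k) = (\<Sum>x\<in>A. shifted_sum (f x))"
  by (rule fps_ext, simp only: shifted_sum_def fps_nth_Abs_fps fps_sum_nth, rule sum.swap)

lemma shifted_sum_const: "shifted_sum (\<lambda>k. fps_const (a k)) = Abs_fps a"
proof (rule fps_ext)
  fix d
  have "(\<Sum>k\<le>d. fps_nth (fps_const (a k)) (d - k)) = (\<Sum>k\<le>d. if k = d then a k else 0)"
    by (rule sum.cong) auto
  then show "fps_nth (shifted_sum (\<lambda>k. fps_const (a k))) d = fps_nth (Abs_fps a) d"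
    by (simp add: shifted_sum_def)
qed

text \<open>Exponent vectors of the monomials of degree \<open>e\<close> in the variables
  \<open>V\<close>.\<close>

definition vectors_of_sum :: "'v set \<Rightarrow> nat \<Rightarrow> ('v \<Rightarrow>\<^sub>0 nat) set" where
  "vectors_of_sum V e =
    {w. Poly_Mapping.keys w \<subseteq> V \<and> (\<Sum>v\<in>V. Poly_Mapping.lookup w v) = e}"

lemma finite_vectors_of_sum:
  assumes "finite V"
  shows "finite (vectors_of_sum V e)"
proof -
  have "finite (V \<rightarrow>\<^sub>E {..e})" using assms by (intro finite_PiE) auto
  moreover have "(\<lambda>w. restrict (Poly_Mapping.lookup w) V) ` vectors_of_sum V e \<subseteq> V \<rightarrow>\<^sub>E {..e}"
    using assms by (auto simp: vectors_of_sum_def intro: member_le_sum)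
  ultimately have "finite ((\<lambda>w. restrict (Poly_Mapping.lookup w) V) ` vectors_of_sum V e)"
    by (rule rev_finite_subset)
  moreover have "inj_on (\<lambda>w. restrict (Poly_Mapping.lookup w) V) (vectors_of_sum V e)"
  proof (rule inj_onI, rule poly_mapping_eqI)
    fix w w' v
    assume w: "w \<in> vectors_of_sum V e" "w' \<in> vectors_of_sum V e"
      and eq: "restrict (Poly_Mapping.lookup w) V = restrict (Poly_Mapping.lookup w') V"
    show "Poly_Mapping.lookup w v = Poly_Mapping.lookup w' v"
    proof (cases "v \<in> V")
      case True
      then show ?thesis using fun_cong[OF eq, of v] by simp
    next
      case False
      then have "v \<notin> Poly_Mapping.keys w" "v \<notin> Poly_Mapping.keys w'"
        using w by (auto simp: vectors_of_sum_def)
      then show ?thesis by (simp add: in_keys_iff)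
    qed
  qed
  ultimately show ?thesis by (rule finite_imageD)
qed

text \<open>Pascal's rule: either \<open>v\<close> does not occur in the monomial, or one factor
  \<open>v\<close> can be split off.\<close>

lemma card_vectors_of_sum_insert:
  assumes "finite V" "v \<notin> V"
  shows "card (vectors_of_sum (insert v V) (Suc e)) =
    card (vectors_of_sum V (Suc e)) + card (vectors_of_sum (insert v V) e)"
proof -
  let ?s = "Poly_Mapping.single v (1::nat)"
  have sum: "(\<Sum>u\<in>insert v V. Poly_Mapping.lookup (?s + w) u) =
      Suc (\<Sum>u\<in>insert v V. Poly_Mapping.lookup w u)" for w
    using assms by (simp add: lookup_add lookup_single sum.distrib when_def cong: sum.cong)
  have "vectors_of_sum (insert v V) (Suc e) =
      vectors_of_sum V (Suc e) \<union> (+) ?s ` vectors_of_sum (insert v V) e" (is "?A = ?B \<union> ?C")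
  proof (intro equalityI subsetI)
    fix w assume w: "w \<in> ?A"
    show "w \<in> ?B \<union> ?C"
    proof (cases "Poly_Mapping.lookup w v = 0")
      case True
      then show ?thesis
        using w assms by (auto simp: vectors_of_sum_def in_keys_iff)
    next
      case False
      define u where "u = w - ?s"
      have wu: "w = ?s + u"
        using False by (intro poly_mapping_eqI)
          (auto simp: u_def lookup_add lookup_minus lookup_single when_def)
      have "Poly_Mapping.keys u \<subseteq> Poly_Mapping.keys w"
        by (auto simp: u_def in_keys_iff lookup_minus)
      then have "u \<in> vectors_of_sum (insert v V) e"
        using w sum[of u] by (auto simp: vectors_of_sum_def wu simp del: sum.insert)
      then show ?thesis using wu by blast
    qed
  next
    fix w assume w: "w \<in> ?B \<union> ?C"
    then show "w \<in> ?A"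
    proof
      assume "w \<in> ?B"
      then show ?thesis using assms by (auto simp: vectors_of_sum_def in_keys_iff)
    next
      assume "w \<in> ?C"
      then obtain u where "w = ?s + u" "u \<in> vectors_of_sum (insert v V) e" by blast
      then show ?thesis
        using sum[of u] Poly_Mapping.keys_add[of ?s u]
        by (auto simp: vectors_of_sum_def simp del: sum.insert)
    qed
  qed
  moreover have "Poly_Mapping.lookup w v = 0" if "w \<in> ?B" for w
    using that assms by (auto simp: vectors_of_sum_def in_keys_iff)
  then have "?B \<inter> ?C = {}"
    by (fastforce simp: lookup_add)
  moreover have "card ?C = card (vectors_of_sum (insert v V) e)"
    by (intro card_image) auto
  ultimately show ?thesis
    using assms by (simp add: card_Un_disjoint finite_vectors_of_sum)
qed

text \<open>This is the Hilbert series of a polynomial ring: by Pascal's rule, each new variable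
  contributes a factor \<open>1/(1-z)\<close>.\<close>

lemma vectors_of_sum_fps:
  assumes "finite V"
  shows "Abs_fps (\<lambda>e. int (card (vectors_of_sum V e))) * (1 - fps_X) ^ card V = 1"
  using assms
proof induction
  case empty
  have "vectors_of_sum {} e = (if e = 0 then {0::'a \<Rightarrow>\<^sub>0 nat} else {})" for e
    by (auto simp: vectors_of_sum_def)
  then show ?case by (intro fps_ext) simp
next
  case (insert v V)
  have zero: "vectors_of_sum U 0 = {0}" if "finite U" for U :: "'a set"
    using that by (auto simp: vectors_of_sum_def in_keys_iff subset_iff intro!: poly_mapping_eqI)
  have "Abs_fps (\<lambda>e. int (card (vectors_of_sum (insert v V) e))) * (1 - fps_X) =
      Abs_fps (\<lambda>e. int (card (vectors_of_sum V e)))"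
  proof (rule fps_ext)
    fix e
    show "fps_nth (Abs_fps (\<lambda>e. int (card (vectors_of_sum (insert v V) e))) * (1 - fps_X)) e =
        fps_nth (Abs_fps (\<lambda>e. int (card (vectors_of_sum V e)))) e"
      using insert.hyps by (cases e) (simp_all add: zero card_vectors_of_sum_insert algebra_simps)
  qed
  then show ?case
    using insert by (simp add: mult.assoc[symmetric])
qed

text \<open>With \<open>F\<close> the disjoint union of \<open>T\<close> and \<open>U\<close>, the
  sum over \<open>U\<close> is the expansion of the product over \<open>I - T\<close> of the factors
  \<open>q + (1 - q) = 1\<close>.\<close>

lemma sum_supersets_binomial:
  fixes q :: "'b::comm_ring_1"
  assumes "finite I" "T \<subseteq> I"
  shows "(\<Sum>F | T \<subseteq> F \<and> F \<subseteq> I. (1 - q) ^ (card I - card F) * q ^ card F) = q ^ card T"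
proof -
  have fin: "finite T" "finite (I - T)" using assms finite_subset by auto
  have "(\<Sum>F | T \<subseteq> F \<and> F \<subseteq> I. (1 - q) ^ (card I - card F) * q ^ card F) =
      (\<Sum>U\<in>Pow (I - T). (1 - q) ^ (card I - card (T \<union> U)) * q ^ card (T \<union> U))"
    by (rule sum.reindex_bij_witness[of _ "\<lambda>U. T \<union> U" "\<lambda>F. F - T"])
      (use assms in \<open>auto simp: Un_absorb1\<close>)
  also have "\<dots> = (\<Sum>U\<in>Pow (I - T). q ^ card T * ((\<Prod>i\<in>U. q) * (\<Prod>i\<in>I - T - U. 1 - q)))"
  proof (rule sum.cong)
    fix U assume U: "U \<in> Pow (I - T)"
    then have "finite U" using fin finite_subset by blast
    then have "card (T \<union> U) = card T + card U"
      using U fin by (intro card_Un_disjoint) auto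
    moreover have "card (I - T - U) = card I - card T - card U"
      using U assms fin \<open>finite U\<close> by (simp add: card_Diff_subset)
    ultimately show "(1 - q) ^ (card I - card (T \<union> U)) * q ^ card (T \<union> U) =
        q ^ card T * ((\<Prod>i\<in>U. q) * (\<Prod>i\<in>I - T - U. 1 - q))"
      by (simp add: power_add)
  qed simp
  also have "\<dots> = q ^ card T * (\<Prod>i\<in>I - T. q + (1 - q))"
    unfolding prod_add[OF fin(2)] by (simp add: sum_distrib_left)
  finally show ?thesis by simp
qed


section \<open>Words compatible with a permutation\<close>

text \<open>The value lists of maps that decrease weakly along the word, and strictly at its
  descents, with \<open>b\<close> a strict bound for the next value. Handing a bound to the rest of
  the word (\<open>s\<close> at a descent, \<open>Suc s\<close> otherwise) makes each letter a
  single summation.\<close>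

fun compatible :: "nat list \<Rightarrow> nat \<Rightarrow> nat list set" where
  "compatible [] b = {[]}"
| "compatible (a # w) b =
    (\<Union>s<b. (#) s ` compatible w (if w \<noteq> [] \<and> hd w < a then s else Suc s))"

lemma finite_compatible: "finite (compatible w b)"
  by (induction w arbitrary: b) auto

lemma length_compatible: "s \<in> compatible w b \<Longrightarrow> length s = length w"
  by (induction w arbitrary: b s) auto

lemma card_compatible_Cons:
  "card (compatible (a # w) b) =
    (\<Sum>s<b. card (compatible w (if w \<noteq> [] \<and> hd w < a then s else Suc s)))"
proof -
  have "card (compatible (a # w) b) =
      (\<Sum>s<b. card ((#) s ` compatible w (if w \<noteq> [] \<and> hd w < a then s else Suc s)))"
    unfolding compatible.simps
    by (intro card_UN_disjoint) (auto simp: finite_compatible)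
  then show ?thesis by (simp add: card_image)
qed

lemma descents_Nil: "descents [] = 0"
  by (simp add: descents_def)

lemma descents_Cons:
  "descents (a # w) = (if w \<noteq> [] \<and> hd w < a then 1 else 0) + descents w"
proof -
  let ?D = "{k. Suc k < length w \<and> w ! k > w ! Suc k}"
  have "{k. Suc k < length (a # w) \<and> (a # w) ! k > (a # w) ! Suc k} =
      {k. k = 0 \<and> w \<noteq> [] \<and> hd w < a} \<union> Suc ` ?D"
  proof (rule set_eqI)
    fix k
    show "k \<in> {k. Suc k < length (a # w) \<and> (a # w) ! k > (a # w) ! Suc k} \<longleftrightarrow>
        k \<in> {k. k = 0 \<and> w \<noteq> [] \<and> hd w < a} \<union> Suc ` ?D"
      by (cases k) (auto simp: hd_conv_nth)
  qed
  moreover have "finite ?D" by (rule finite_subset[of _ "{..length w}"]) auto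
  then have "card ({k. k = 0 \<and> w \<noteq> [] \<and> hd w < a} \<union> Suc ` ?D) =
      card {k. k = (0::nat) \<and> w \<noteq> [] \<and> hd w < a} + card ?D"
    by (subst card_Un_disjoint) (auto simp: card_image)
  moreover have "{k. k = (0::nat) \<and> w \<noteq> [] \<and> hd w < a} = (if w \<noteq> [] \<and> hd w < a then {0} else {})"
    by auto
  ultimately show ?thesis by (simp add: descents_def)
qed

text \<open>Each letter is one partial summation, that is, a division by \<open>1 - z\<close>. A
  descent lowers the bound by one, which multiplies the series by \<open>z\<close>. The extra factor
  \<open>1 - z\<close> belongs to the empty word, whose series is \<open>1/(1-z)\<close>.\<close>

lemma compatible_fps:
  "Abs_fps (\<lambda>k. int (card (compatible w (Suc k)))) * (1 - fps_X) ^ Suc (length w) =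
    fps_X ^ descents w"
proof (induction w)
  case Nil
  show ?case
    using partial_sums_fps[of "\<lambda>i. if i = 0 then 1 else (0::int)"]
    by (simp add: descents_Nil fps_eq_iff)
next
  case (Cons a w)
  let ?g = "\<lambda>w. Abs_fps (\<lambda>k. int (card (compatible w (Suc k))))"
  let ?d = "if w \<noteq> [] \<and> hd w < a then 1 else 0 :: nat"
  have "?g (a # w) * (1 - fps_X) =
      Abs_fps (\<lambda>s. int (card (compatible w (if w \<noteq> [] \<and> hd w < a then s else Suc s))))"
    unfolding card_compatible_Cons lessThan_Suc_atMost of_nat_sum by (rule partial_sums_fps)
  \<comment> \<open>At \<open>k = 0\<close> a descent leaves the bound 0 for a nonempty word, hence
    no list, in accordance with the vanishing constant term on the right.\<close>
  also have "\<dots> = fps_X ^ ?d * ?g w"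
  proof (rule fps_ext)
    fix k
    show "fps_nth (Abs_fps (\<lambda>s. int (card (compatible w
          (if w \<noteq> [] \<and> hd w < a then s else Suc s))))) k = fps_nth (fps_X ^ ?d * ?g w) k"
      by (cases k; cases w) auto
  qed
  finally have "?g (a # w) * (1 - fps_X) ^ Suc (length (a # w)) =
      fps_X ^ ?d * (?g w * (1 - fps_X) ^ Suc (length w))"
    by (simp add: mult.assoc[symmetric])
  then show ?case
    unfolding Cons.IH descents_Cons power_add .
qed

text \<open>Along a word, \<open>f\<close> decreases weakly, and strictly at descents; by transitivity this can be
  expressed by comparing all pairs of positions instead of adjacent ones.\<close>

definition precedes :: "(nat \<Rightarrow> nat) \<Rightarrow> nat \<Rightarrow> nat \<Rightarrow> bool" where
  "precedes f i j \<longleftrightarrow> f j < f i \<or> f j = f i \<and> i < j"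

lemma map_in_compatible_iff:
  assumes "distinct w"
  shows "map f w \<in> compatible w b \<longleftrightarrow> (\<forall>i\<in>set w. f i < b) \<and> sorted_wrt (precedes f) w"
  using assms
proof (induction w arbitrary: b)
  case (Cons a w)
  let ?b = "if w \<noteq> [] \<and> hd w < a then f a else Suc (f a)"
  have "map f (a # w) \<in> compatible (a # w) b \<longleftrightarrow> f a < b \<and> map f w \<in> compatible w ?b"
    by auto
  also have "\<dots> \<longleftrightarrow> f a < b \<and> (\<forall>i\<in>set w. f i < ?b) \<and> sorted_wrt (precedes f) w"
    using Cons by simp
  also have "\<dots> \<longleftrightarrow> (\<forall>i\<in>set (a # w). f i < b) \<and> sorted_wrt (precedes f) (a # w)"
  proof (cases "w = []")
    case False
    then obtain c v where w: "w = c # v" by (cases w) auto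
    \<comment> \<open>On the sorted rest \<open>w\<close>, the head \<open>c\<close> has the largest
      value, and the smallest index among those with that value. Comparing \<open>a\<close> with
      \<open>c\<close> therefore decides the comparison with all of \<open>w\<close>.\<close>
    have le: "f i \<le> f c" if "sorted_wrt (precedes f) w" "i \<in> set w" for i
      using that by (auto simp: w precedes_def)
    have less: "c < i" if "sorted_wrt (precedes f) w" "i \<in> set w" "i \<noteq> c" "f i = f c" for i
      using that by (auto simp: w precedes_def)
    from w Cons.prems consider "c < a" | "a < c" by (metis distinct_length_2_or_more linorder_neqE_nat)
    then show ?thesis
    proof cases
      case 1
      have "(\<forall>i\<in>set w. f i < f a) \<longleftrightarrow> (\<forall>i\<in>set w. precedes f a i)"
        if s: "sorted_wrt (precedes f) w"
      proof
        assume *: "\<forall>i\<in>set w. precedes f a i"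
        then have "f c < f a" using 1 by (simp add: w precedes_def)
        then show "\<forall>i\<in>set w. f i < f a" using le[OF s] by (meson order_le_less_trans)
      qed (simp add: precedes_def)
      then show ?thesis using 1 by (auto simp: w)
    next
      case 2
      have "(\<forall>i\<in>set w. f i < Suc (f a)) \<longleftrightarrow> (\<forall>i\<in>set w. precedes f a i)"
        if s: "sorted_wrt (precedes f) w"
      proof
        assume *: "\<forall>i\<in>set w. f i < Suc (f a)"
        show "\<forall>i\<in>set w. precedes f a i"
        proof
          fix i assume i: "i \<in> set w"
          have "f i \<le> f c" "f c \<le> f a" using le[OF s i] * by (auto simp: w)
          then show "precedes f a i"
            using less[OF s i] 2 by (cases "i = c") (auto simp: precedes_def)
        qed
      qed (auto simp: less_Suc_eq_le precedes_def)
      then show ?thesis using 2 by (auto simp: w)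
    qed
  qed auto
  finally show ?case .
qed simp

lemma card_compatible_maps:
  assumes "distinct w" "set w = F"
  shows "card {f \<in> F \<rightarrow>\<^sub>E {..k}. sorted_wrt (precedes f) w} = card (compatible w (Suc k))"
proof (rule bij_betw_same_card[of "\<lambda>f. map f w"], rule bij_betw_imageI)
  show "inj_on (\<lambda>f. map f w) {f \<in> F \<rightarrow>\<^sub>E {..k}. sorted_wrt (precedes f) w}"
    using assms(2) by (intro inj_onI PiE_ext[of _ F "\<lambda>_. {..k}"]) auto
  show "(\<lambda>f. map f w) ` {f \<in> F \<rightarrow>\<^sub>E {..k}. sorted_wrt (precedes f) w} = compatible w (Suc k)"
  proof (intro equalityI subsetI)
    fix s assume "s \<in> (\<lambda>f. map f w) ` {f \<in> F \<rightarrow>\<^sub>E {..k}. sorted_wrt (precedes f) w}"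
    then show "s \<in> compatible w (Suc k)"
      using map_in_compatible_iff[OF assms(1)] assms(2) by (auto simp: less_Suc_eq_le)
  next
    fix s assume s: "s \<in> compatible w (Suc k)"
    define f where "f = restrict (\<lambda>i. the (map_of (zip w s) i)) F"
    have "map f w = s"
      using length_compatible[OF s] assms
      by (intro nth_equalityI) (auto simp: f_def map_of_zip_nth)
    moreover have "(\<forall>i\<in>set w. f i < Suc k) \<and> sorted_wrt (precedes f) w"
      unfolding map_in_compatible_iff[OF assms(1), symmetric] \<open>map f w = s\<close> by (rule s)
    ultimately show "s \<in> (\<lambda>f. map f w) ` {f \<in> F \<rightarrow>\<^sub>E {..k}. sorted_wrt (precedes f) w}"
      using assms(2) by (intro image_eqI[of _ _ f]) (auto simp: f_def less_Suc_eq_le)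
  qed
qed

text \<open>\<open>precedes f\<close> is a strict total order on \<open>F\<close>, so it sorts
  \<open>F\<close> in exactly one way. Every map thus has a unique word, and the count over words is
  free of repetitions.\<close>

lemma ex1_sorted_wrt_precedes:
  assumes "finite F" "\<And>i. i \<in> F \<Longrightarrow> f i \<le> (k::nat)"
  shows "\<exists>!w. set w = F \<and> sorted_wrt (precedes f) w"
proof -
  \<comment> \<open>In the lexicographic order of pairs, \<open>k - f i\<close> reverses the
    comparison of values, which loses nothing since all values are at most \<open>k\<close>; the
    second component breaks ties by index.\<close>
  define key where "key = (\<lambda>i. (k - f i, i))"
  have key_less: "precedes f i j \<longleftrightarrow> key i < key j" if "i \<in> F" "j \<in> F" for i j
    using assms(2)[OF that(1)] assms(2)[OF that(2)] by (auto simp: key_def precedes_def)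
  have sorted: "sorted_wrt (precedes f) w \<longleftrightarrow> sorted_wrt (<) (map key w)" if w: "set w = F" for w
    unfolding sorted_wrt_map
    using sorted_wrt_mono_rel[of w "precedes f" "\<lambda>i j. key i < key j"]
      sorted_wrt_mono_rel[of w "\<lambda>i j. key i < key j" "precedes f"] key_less w by blast
  let ?s = "sorted_list_of_set (key ` F)"
  have map_snd: "map snd (map key w) = w" for w by (simp add: key_def comp_def)
  have map_key: "map key (map snd ?s) = ?s"
    unfolding map_map by (rule map_idI) (use assms(1) in \<open>auto simp: key_def\<close>)
  show ?thesis
  proof (rule ex1I[of _ "map snd ?s"])
    have "set (map snd ?s) = F" using assms(1) by (simp add: image_image key_def)
    then show "set (map snd ?s) = F \<and> sorted_wrt (precedes f) (map snd ?s)"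
      using sorted map_key by (simp del: map_map)
  next
    fix w assume w: "set w = F \<and> sorted_wrt (precedes f) w"
    have "map key w = ?s"
      using w sorted assms(1)
      by (intro strict_sorted_equal) auto
    then show "w = map snd ?s" using map_snd by metis
  qed
qed


section \<open>Antitone maps on naturally labelled posets\<close>

text \<open>The poset is transferred to its indices, so that the usual order of \<open>nat\<close>
  serves as the natural labelling; antisymmetry follows from \<open>leq_imp_le\<close>.\<close>

locale natural_poset =
  fixes I :: "nat set" and le :: "nat \<Rightarrow> nat \<Rightarrow> bool" (infix \<open>\<sqsubseteq>\<close> 50)
  assumes finite_carrier: "finite I"
    and leq_refl: "i \<in> I \<Longrightarrow> i \<sqsubseteq> i"
    and leq_trans: "i \<in> I \<Longrightarrow> j \<in> I \<Longrightarrow> k \<in> I \<Longrightarrow> i \<sqsubseteq> j \<Longrightarrow> j \<sqsubseteq> k \<Longrightarrow> i \<sqsubseteq> k"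
    and leq_imp_le: "i \<in> I \<Longrightarrow> j \<in> I \<Longrightarrow> i \<sqsubseteq> j \<Longrightarrow> i \<le> j"
begin

text \<open>P-partitions on \<open>F\<close> with parts at most \<open>k\<close>. Being extensional,
  they are determined by their values on \<open>F\<close> and can be counted.\<close>

definition antitone_maps :: "nat set \<Rightarrow> nat \<Rightarrow> (nat \<Rightarrow> nat) set" where
  "antitone_maps F k = {f \<in> F \<rightarrow>\<^sub>E {..k}. \<forall>i\<in>F. \<forall>j\<in>F. i \<sqsubseteq> j \<longrightarrow> f j \<le> f i}"

definition strict_points :: "(nat \<Rightarrow> nat) \<Rightarrow> nat set" where
  "strict_points f = {i \<in> I. 0 < f i \<and> (\<forall>j\<in>I. i \<sqsubseteq> j \<and> j \<noteq> i \<longrightarrow> f j < f i)}"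

definition linexts :: "nat set \<Rightarrow> nat list set" where
  "linexts F = {w. distinct w \<and> set w = F \<and> sorted_wrt (\<lambda>i j. \<not> j \<sqsubseteq> i) w}"

lemma finite_below: "F \<subseteq> I \<Longrightarrow> finite F"
  using finite_carrier by (rule rev_finite_subset)

lemma antitone_maps_le: "f \<in> antitone_maps F k \<Longrightarrow> i \<in> F \<Longrightarrow> f i \<le> k"
  by (auto simp: antitone_maps_def)

lemma finite_antitone_maps: "finite F \<Longrightarrow> finite (antitone_maps F k)"
  by (rule finite_subset[of _ "F \<rightarrow>\<^sub>E {..k}"]) (auto simp: antitone_maps_def intro: finite_PiE)

lemma finite_linexts: "finite F \<Longrightarrow> finite (linexts F)"
  by (rule finite_subset[OF _ finite_subset_distinct]) (auto simp: linexts_def)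

section \<open>Antitone maps and their strict points\<close>

lemma strict_points_subset: "strict_points f \<subseteq> I"
  by (auto simp: strict_points_def)

text \<open>Among the points above \<open>i\<close> with the same value, the one with the largest
  index is strict: a further point above it with that value would have a larger index, the labelling
  being natural.\<close>

lemma strict_point_above:
  assumes f: "f \<in> antitone_maps I k" and i: "i \<in> I" "0 < f i"
  shows "\<exists>j\<in>strict_points f. i \<sqsubseteq> j \<and> f j = f i"
proof -
  let ?A = "{j \<in> I. i \<sqsubseteq> j \<and> f j = f i}"
  have fin: "finite ?A" using finite_carrier by simp
  have "i \<in> ?A" using i leq_refl by simp
  then have M: "Max ?A \<in> ?A" using fin Max_in by blast
  have "f l < f (Max ?A)" if l: "l \<in> I" "Max ?A \<sqsubseteq> l" "l \<noteq> Max ?A" for l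
  proof (rule ccontr)
    assume "\<not> f l < f (Max ?A)"
    then have "f l = f i" using f M l by (force simp: antitone_maps_def)
    then have "l \<in> ?A" using leq_trans[OF i(1) _ l(1)] M l by blast
    then have "l \<le> Max ?A" using fin by (rule Max_ge[rotated])
    then show False using leq_imp_le[OF _ l(1,2)] M l(3) by simp
  qed
  then have "Max ?A \<in> strict_points f"
    using M i by (auto simp: strict_points_def)
  then show ?thesis using M by blast
qed

text \<open>Every positive value is attained at a strict point above, so a map is determined by its
  restriction to any set containing its strict points. The inserted 0 covers points of value 0,
  above which \<open>F\<close> may have no point at all.\<close>

lemma antitone_map_eq_Max:
  assumes f: "f \<in> antitone_maps I k" and F: "strict_points f \<subseteq> F" "F \<subseteq> I" and i: "i \<in> I"
  shows "f i = Max (insert 0 (f ` {j \<in> F. i \<sqsubseteq> j}))"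
proof (rule Max_eqI[symmetric])
  show "finite (insert 0 (f ` {j \<in> F. i \<sqsubseteq> j}))"
    using finite_below[OF F(2)] by auto
  show "y \<le> f i" if "y \<in> insert 0 (f ` {j \<in> F. i \<sqsubseteq> j})" for y
    using that f F i by (auto simp: antitone_maps_def)
  show "f i \<in> insert 0 (f ` {j \<in> F. i \<sqsubseteq> j})"
  proof (cases "f i = 0")
    case False
    then obtain j where "j \<in> strict_points f" "i \<sqsubseteq> j" "f j = f i"
      using strict_point_above[OF f i] by auto
    then show ?thesis using F by (metis (mono_tags, lifting) imageI insertI2 mem_Collect_eq subsetD)
  qed simp
qed

lemma bij_betw_restrict_antitone_maps:
  assumes F: "F \<subseteq> I"
  shows "bij_betw (\<lambda>f. restrict f F) {f \<in> antitone_maps I k. strict_points f \<subseteq> F} (antitone_maps F k)"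
proof (rule bij_betw_imageI)
  show "inj_on (\<lambda>f. restrict f F) {f \<in> antitone_maps I k. strict_points f \<subseteq> F}"
  proof (rule inj_onI)
    fix f g
    assume f: "f \<in> {f \<in> antitone_maps I k. strict_points f \<subseteq> F}"
      and g: "g \<in> {f \<in> antitone_maps I k. strict_points f \<subseteq> F}"
      and eq: "restrict f F = restrict g F"
    have eqF: "f j = g j" if "j \<in> F" for j using fun_cong[OF eq, of j] that by simp
    have "f i = g i" if i: "i \<in> I" for i
    proof -
      have "f ` {j \<in> F. i \<sqsubseteq> j} = g ` {j \<in> F. i \<sqsubseteq> j}" using eqF by (intro image_cong) auto
      then show ?thesis
        using antitone_map_eq_Max[of f k F i] antitone_map_eq_Max[of g k F i] f g F i by simp
    qed
    then show "f = g"
      using f g by (intro PiE_ext[of f I "\<lambda>_. {..k}" g]) (auto simp: antitone_maps_def)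
  qed
  show "(\<lambda>f. restrict f F) ` {f \<in> antitone_maps I k. strict_points f \<subseteq> F} = antitone_maps F k"
  proof (intro equalityI subsetI)
    fix g assume "g \<in> (\<lambda>f. restrict f F) ` {f \<in> antitone_maps I k. strict_points f \<subseteq> F}"
    then obtain f where "f \<in> antitone_maps I k" "g = restrict f F" by auto
    then show "g \<in> antitone_maps F k"
      using F by (auto simp: antitone_maps_def subset_iff)
  next
    fix g assume g: "g \<in> antitone_maps F k"
    \<comment> \<open>By \<open>antitone_map_eq_Max\<close>, the maximum of \<open>S i\<close> is
      the only possible value at \<open>i\<close> for an extension of \<open>g\<close> with strict
      points in \<open>F\<close>.\<close>
    define S where "S i = insert 0 (g ` {j \<in> F. i \<sqsubseteq> j})" for i
    define f where "f = restrict (\<lambda>i. Max (S i)) I"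
    have finS: "finite (S i)" and neS: "S i \<noteq> {}" for i
      using finite_below[OF F] by (auto simp: S_def)
    have fg: "f i = g i" if "i \<in> F" for i
    proof -
      have "Max (S i) = g i"
        using that g F leq_refl by (intro Max_eqI finS) (auto simp: S_def antitone_maps_def)
      then show ?thesis using that F by (auto simp: f_def)
    qed
    have "Max (S i) \<le> k" for i
      using Max_in[OF finS neS, of i] g by (auto simp: S_def antitone_maps_def)
    moreover have "Max (S j) \<le> Max (S i)" if "i \<in> I" "j \<in> I" "i \<sqsubseteq> j" for i j
    proof (intro Max_mono finS neS)
      have "{l \<in> F. j \<sqsubseteq> l} \<subseteq> {l \<in> F. i \<sqsubseteq> l}"
        using leq_trans[OF that(1,2) _ that(3)] F by blast
      then show "S j \<subseteq> S i" by (auto simp: S_def)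
    qed
    ultimately have f: "f \<in> antitone_maps I k"
      by (auto simp: antitone_maps_def f_def)
    \<comment> \<open>The positive value of \<open>f\<close> at a strict point \<open>i\<close>
      comes from some \<open>j\<close> of \<open>F\<close> above it, where \<open>f\<close> has the
      same value; strictness forces \<open>j = i\<close>.\<close>
    have "i \<in> F" if i: "i \<in> strict_points f" for i
    proof -
      have "0 < f i" "i \<in> I" using i by (auto simp: strict_points_def)
      moreover have "f i \<in> S i" using \<open>i \<in> I\<close> Max_in[OF finS neS, of i] by (simp add: f_def)
      ultimately obtain j where j: "j \<in> F" "i \<sqsubseteq> j" "f i = g j" by (auto simp: S_def)
      then have "j = i" using i F fg[of j] by (force simp: strict_points_def)
      then show ?thesis using j by simp
    qed
    moreover have "restrict f F = g"
      using fg g by (intro extensionalityI[of _ F]) (auto simp: antitone_maps_def PiE_iff)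
    ultimately show "g \<in> (\<lambda>f. restrict f F) ` {f \<in> antitone_maps I k. strict_points f \<subseteq> F}"
      using f by blast
  qed
qed

text \<open>The power for each map is expanded over the supersets \<open>F\<close> of its strict
  points, and the two sums are swapped. The bijection by restriction then counts the maps belonging
  to a fixed \<open>F\<close>.\<close>

lemma sum_power_strict_points:
  fixes q :: "'b::comm_ring_1"
  shows "(\<Sum>f\<in>antitone_maps I k. q ^ card (strict_points f)) =
    (\<Sum>F\<in>Pow I. (1 - q) ^ (card I - card F) * q ^ card F * of_nat (card (antitone_maps F k)))"
proof -
  have "(\<Sum>f\<in>antitone_maps I k. q ^ card (strict_points f)) =
      (\<Sum>f\<in>antitone_maps I k. \<Sum>F\<in>{F \<in> Pow I. strict_points f \<subseteq> F}.
        (1 - q) ^ (card I - card F) * q ^ card F)"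
    using sum_supersets_binomial[OF finite_carrier strict_points_subset, of q]
    by (simp add: conj_commute)
  also have "\<dots> = (\<Sum>F\<in>Pow I. \<Sum>f\<in>{f \<in> antitone_maps I k. strict_points f \<subseteq> F}.
        (1 - q) ^ (card I - card F) * q ^ card F)"
    using finite_carrier by (intro sum.swap_restrict finite_antitone_maps) auto
  also have "\<dots> = (\<Sum>F\<in>Pow I. (1 - q) ^ (card I - card F) * q ^ card F * of_nat (card (antitone_maps F k)))"
    using bij_betw_same_card[OF bij_betw_restrict_antitone_maps]
    by (intro sum.cong) (simp_all add: mult.commute)
  finally show ?thesis .
qed

section \<open>Stanley's count of P-partitions\<close>

text \<open>The word of a map sorts the points by decreasing value, then by increasing index. It is
  a linear extension since a point below another has at least the same value and a smaller index.
  Conversely, a map sorted along a linear extension cannot increase upwards.\<close>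

lemma antitone_maps_eq_UN:
  assumes F: "F \<subseteq> I"
  shows "antitone_maps F k = (\<Union>w\<in>linexts F. {f \<in> F \<rightarrow>\<^sub>E {..k}. sorted_wrt (precedes f) w})"
proof (intro equalityI subsetI)
  fix f assume f: "f \<in> antitone_maps F k"
  have "finite F" by (rule finite_below[OF F])
  moreover have "f i \<le> k" if "i \<in> F" for i using that f by (auto simp: antitone_maps_def)
  ultimately obtain w where w: "set w = F" "sorted_wrt (precedes f) w"
    using ex1_sorted_wrt_precedes[of F f k] by blast
  have "distinct w"
    unfolding distinct_conv_nth
  proof (intro allI impI)
    fix i j assume "i < length w" "j < length w" "i \<noteq> j"
    then show "w ! i \<noteq> w ! j"
      using w(2) by (cases i j rule: linorder_cases) (force simp: sorted_wrt_iff_nth_less precedes_def)+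
  qed
  moreover have "sorted_wrt (\<lambda>i j. \<not> j \<sqsubseteq> i) w"
  proof (rule sorted_wrt_mono_rel[OF _ w(2)])
    fix i j assume ij: "i \<in> set w" "j \<in> set w" "precedes f i j"
    show "\<not> j \<sqsubseteq> i"
    proof
      assume "j \<sqsubseteq> i"
      then have "j \<le> i" "f i \<le> f j"
        using ij w(1) F f leq_imp_le[of j i] by (auto simp: antitone_maps_def)
      then show False using ij(3) by (auto simp: precedes_def)
    qed
  qed
  ultimately have "w \<in> linexts F" using w by (simp add: linexts_def)
  then show "f \<in> (\<Union>w\<in>linexts F. {f \<in> F \<rightarrow>\<^sub>E {..k}. sorted_wrt (precedes f) w})"
    using f w by (auto simp: antitone_maps_def)
next
  fix f assume "f \<in> (\<Union>w\<in>linexts F. {f \<in> F \<rightarrow>\<^sub>E {..k}. sorted_wrt (precedes f) w})"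
  then obtain w where w: "distinct w" "set w = F" "sorted_wrt (\<lambda>i j. \<not> j \<sqsubseteq> i) w"
    "sorted_wrt (precedes f) w" and f: "f \<in> F \<rightarrow>\<^sub>E {..k}"
    by (auto simp: linexts_def)
  have "f j \<le> f i" if ij: "i \<in> F" "j \<in> F" "i \<sqsubseteq> j" for i j
  proof -
    obtain a b where ab: "a < length w" "b < length w" "i = w ! a" "j = w ! b"
      using ij w(2) by (metis in_set_conv_nth)
    have "\<not> b < a" using ab ij w(3) by (auto simp: sorted_wrt_iff_nth_less)
    then have "a = b \<or> precedes f (w ! a) (w ! b)"
      using ab w(4) by (metis linorder_neqE_nat sorted_wrt_iff_nth_less)
    then show ?thesis using ab by (auto simp: precedes_def)
  qed
  then show "f \<in> antitone_maps F k" using f by (auto simp: antitone_maps_def)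
qed

lemma card_antitone_maps:
  assumes F: "F \<subseteq> I"
  shows "card (antitone_maps F k) = (\<Sum>w\<in>linexts F. card (compatible w (Suc k)))"
proof -
  have fin: "finite F" by (rule finite_below[OF F])
  have "card (antitone_maps F k) =
      (\<Sum>w\<in>linexts F. card {f \<in> F \<rightarrow>\<^sub>E {..k}. sorted_wrt (precedes f) w})"
    unfolding antitone_maps_eq_UN[OF F]
  proof (rule card_UN_disjoint)
    show "\<forall>w\<in>linexts F. finite {f \<in> F \<rightarrow>\<^sub>E {..k}. sorted_wrt (precedes f) w}"
      using fin by (auto intro: finite_PiE finite_subset[of _ "F \<rightarrow>\<^sub>E {..k}"])
    show "\<forall>v\<in>linexts F. \<forall>w\<in>linexts F. v \<noteq> w \<longrightarrow>
        {f \<in> F \<rightarrow>\<^sub>E {..k}. sorted_wrt (precedes f) v} \<inter>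
        {f \<in> F \<rightarrow>\<^sub>E {..k}. sorted_wrt (precedes f) w} = {}"
    proof (intro ballI impI equals0I)
      fix v w f
      assume "v \<in> linexts F" "w \<in> linexts F" "v \<noteq> w"
        and "f \<in> {f \<in> F \<rightarrow>\<^sub>E {..k}. sorted_wrt (precedes f) v} \<inter>
          {f \<in> F \<rightarrow>\<^sub>E {..k}. sorted_wrt (precedes f) w}"
      moreover from this have "f i \<le> k" if "i \<in> F" for i using that by auto
      ultimately show False
        using ex1_sorted_wrt_precedes[OF fin, of f k] by (auto simp: linexts_def)
    qed
  qed (use fin in \<open>rule finite_linexts\<close>)
  also have "\<dots> = (\<Sum>w\<in>linexts F. card (compatible w (Suc k)))"
    by (intro sum.cong card_compatible_maps) (auto simp: linexts_def)
  finally show ?thesis .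
qed

lemma antitone_maps_fps:
  assumes F: "F \<subseteq> I"
  shows "Abs_fps (\<lambda>k. int (card (antitone_maps F k))) * (1 - fps_X) ^ Suc (card F) =
    (\<Sum>w\<in>linexts F. fps_X ^ descents w)"
proof -
  have "Abs_fps (\<lambda>k. int (card (antitone_maps F k))) =
      (\<Sum>w\<in>linexts F. Abs_fps (\<lambda>k. int (card (compatible w (Suc k)))))"
    by (rule fps_ext) (simp add: card_antitone_maps[OF F] fps_sum_nth)
  moreover have "card F = length w" if "w \<in> linexts F" for w
    using that distinct_card[of w] by (simp add: linexts_def)
  ultimately show ?thesis
    by (simp only: sum_distrib_right compatible_fps cong: sum.cong)
qed


subsection \<open>Decomposition of covers\<close>

definition is_cover :: "nat \<Rightarrow> (vertex \<Rightarrow>\<^sub>0 nat) \<Rightarrow> bool" where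
  "is_cover k c \<longleftrightarrow> Poly_Mapping.keys c \<subseteq> X ` I \<union> Y ` I \<and>
    (\<forall>i\<in>I. \<forall>j\<in>I. i \<sqsubseteq> j \<longrightarrow> k \<le> Poly_Mapping.lookup c (X i) + Poly_Mapping.lookup c (Y j))"

text \<open>For an antitone map \<open>f\<close> bounded by \<open>k\<close>, this is a
  \<open>k\<close>-cover in which \<open>X i\<close> and \<open>Y i\<close> add up to exactly
  \<open>k\<close>. The tests for membership in \<open>I\<close> keep the support finite, as
  \<open>Abs_poly_mapping\<close> requires.\<close>

definition cover_of :: "nat \<Rightarrow> (nat \<Rightarrow> nat) \<Rightarrow> vertex \<Rightarrow>\<^sub>0 nat" where
  "cover_of k f = Abs_poly_mapping (\<lambda>v. case v of
     X i \<Rightarrow> if i \<in> I then f i else 0 | Y i \<Rightarrow> if i \<in> I then k - f i else 0)"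

text \<open>For a strict \<open>i\<close>, the exponent of \<open>Y i\<close> alone forces the value
  \<open>f i\<close>, so raising it would change the map of the cover; all other exponents may be
  raised freely.\<close>

definition free_vertices :: "(nat \<Rightarrow> nat) \<Rightarrow> vertex set" where
  "free_vertices f = X ` I \<union> Y ` (I - strict_points f)"

text \<open>The edge from \<open>X i\<close> to \<open>Y j\<close> demands at \<open>X i\<close> at
  least \<open>k\<close> minus the exponent of \<open>Y j\<close>; the maximum over \<open>j\<close>
  is the least exponent allowed at \<open>X i\<close>. Truncated subtraction gives 0 when the edge
  demands nothing.\<close>

definition map_of_cover :: "nat \<Rightarrow> (vertex \<Rightarrow>\<^sub>0 nat) \<Rightarrow> nat \<Rightarrow> nat" where
  "map_of_cover k c =
    restrict (\<lambda>i. Max ((\<lambda>j. k - Poly_Mapping.lookup c (Y j)) ` {j \<in> I. i \<sqsubseteq> j})) I"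

lemma lookup_cover_of:
  "Poly_Mapping.lookup (cover_of k f) (X i) = (if i \<in> I then f i else 0)"
  "Poly_Mapping.lookup (cover_of k f) (Y i) = (if i \<in> I then k - f i else 0)"
proof -
  have "Poly_Mapping.lookup (cover_of k f) = (\<lambda>v. case v of
     X i \<Rightarrow> if i \<in> I then f i else 0 | Y i \<Rightarrow> if i \<in> I then k - f i else 0)"
    unfolding cover_of_def
  proof (rule lookup_Abs_poly_mapping, rule finite_subset)
    show "finite (X ` I \<union> Y ` I)" using finite_carrier by simp
    show "{v. (case v of X i \<Rightarrow> if i \<in> I then f i else 0 | Y i \<Rightarrow> if i \<in> I then k - f i else 0) \<noteq> 0}
        \<subseteq> X ` I \<union> Y ` I"
    proof
      fix v
      assume "v \<in> {v. (case v of X i \<Rightarrow> if i \<in> I then f i else 0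
        | Y i \<Rightarrow> if i \<in> I then k - f i else 0) \<noteq> 0}"
      then show "v \<in> X ` I \<union> Y ` I" by (cases v) (auto split: if_splits)
    qed
  qed
  then show "Poly_Mapping.lookup (cover_of k f) (X i) = (if i \<in> I then f i else 0)"
    "Poly_Mapping.lookup (cover_of k f) (Y i) = (if i \<in> I then k - f i else 0)"
    by simp_all
qed

lemma keys_cover_of: "Poly_Mapping.keys (cover_of k f) \<subseteq> X ` I \<union> Y ` I"
proof
  fix v assume "v \<in> Poly_Mapping.keys (cover_of k f)"
  then show "v \<in> X ` I \<union> Y ` I"
    by (cases v) (auto simp: in_keys_iff lookup_cover_of split: if_splits)
qed

lemma sum_vertices: "sum g (X ` I \<union> Y ` J) = (\<Sum>i\<in>I. g (X i)) + (\<Sum>i\<in>J. g (Y i))"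
  if "finite J" for g :: "vertex \<Rightarrow> nat"
  using finite_carrier that by (subst sum.union_disjoint) (auto simp: sum.reindex inj_on_def)

lemma free_vertices_subset: "free_vertices f \<subseteq> X ` I \<union> Y ` I"
  by (auto simp: free_vertices_def)

lemma finite_free_vertices: "finite (free_vertices f)"
  using finite_carrier by (simp add: free_vertices_def)

lemma card_free_vertices: "card (free_vertices f) + card (strict_points f) = 2 * card I"
proof -
  have "card (I - strict_points f) + card (strict_points f) = card I"
    using finite_carrier strict_points_subset[of f]
    by (metis card_Diff_subset card_mono finite_subset le_add_diff_inverse2)
  moreover have "card (free_vertices f) = card I + card (I - strict_points f)"
    using finite_carrier unfolding free_vertices_def
    by (subst card_Un_disjoint) (auto simp: card_image inj_on_def)
  ultimately show ?thesis by simp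
qed

lemma sum_cover_of_add:
  assumes f: "f \<in> antitone_maps I k" and w: "Poly_Mapping.keys w \<subseteq> free_vertices f"
  shows "(\<Sum>v\<in>X ` I \<union> Y ` I. Poly_Mapping.lookup (cover_of k f + w) v) =
    card I * k + (\<Sum>v\<in>free_vertices f. Poly_Mapping.lookup w v)"
proof -
  have "(\<Sum>v\<in>X ` I \<union> Y ` I. Poly_Mapping.lookup (cover_of k f) v) = (\<Sum>i\<in>I. f i + (k - f i))"
    by (simp add: sum_vertices finite_carrier lookup_cover_of sum.distrib)
  also have "\<dots> = (\<Sum>i\<in>I. k)"
    using antitone_maps_le[OF f] by (intro sum.cong) simp_all
  also have "\<dots> = card I * k" by simp
  finally have 1: "(\<Sum>v\<in>X ` I \<union> Y ` I. Poly_Mapping.lookup (cover_of k f) v) = card I * k" .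
  have 2: "(\<Sum>v\<in>X ` I \<union> Y ` I. Poly_Mapping.lookup w v) = (\<Sum>v\<in>free_vertices f. Poly_Mapping.lookup w v)"
    using w free_vertices_subset finite_carrier by (intro sum.mono_neutral_right) (auto simp: in_keys_iff)
  show ?thesis unfolding lookup_add sum.distrib 1 2 ..
qed

lemma is_cover_cover_of_add:
  assumes f: "f \<in> antitone_maps I k" and w: "Poly_Mapping.keys w \<subseteq> free_vertices f"
  shows "is_cover k (cover_of k f + w)"
proof -
  have "Poly_Mapping.keys (cover_of k f + w) \<subseteq> X ` I \<union> Y ` I"
    using Poly_Mapping.keys_add[of "cover_of k f" w] keys_cover_of[of k f] w free_vertices_subset[of f]
    by blast
  moreover have "k \<le> f i + (k - f j)" if "i \<in> I" "j \<in> I" "i \<sqsubseteq> j" for i j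
    using f that by (fastforce simp: antitone_maps_def)
  ultimately show ?thesis
    by (fastforce simp: is_cover_def lookup_add lookup_cover_of)
qed

text \<open>Adding \<open>w\<close> can only lower the demands of the \<open>Y j\<close>. A positive
  demand \<open>f i\<close> survives because it is attained at a strict point above
  \<open>i\<close>, whose \<open>Y\<close> vertex is not free.\<close>

lemma map_of_cover_cover_of_add:
  assumes f: "f \<in> antitone_maps I k" and w: "Poly_Mapping.keys w \<subseteq> free_vertices f"
  shows "map_of_cover k (cover_of k f + w) = f"
proof (rule extensionalityI[of _ I])
  show "f \<in> extensional I" using f PiE_iff[of f I] by (simp add: antitone_maps_def)
  fix i assume i: "i \<in> I"
  let ?g = "\<lambda>j. k - Poly_Mapping.lookup (cover_of k f + w) (Y j)"
  have g: "?g j \<le> f j" if "j \<in> I" for j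
    using that by (simp add: lookup_add lookup_cover_of)
  have "Max (?g ` {j \<in> I. i \<sqsubseteq> j}) = f i"
  proof (rule Max_eqI)
    show "finite (?g ` {j \<in> I. i \<sqsubseteq> j})" using finite_carrier by simp
    show "y \<le> f i" if "y \<in> ?g ` {j \<in> I. i \<sqsubseteq> j}" for y
    proof -
      from that obtain j where j: "j \<in> I" "i \<sqsubseteq> j" "y = ?g j" by auto
      have "?g j \<le> f j" "f j \<le> f i" using g f i j by (auto simp: antitone_maps_def)
      then show ?thesis using j by simp
    qed
    show "f i \<in> ?g ` {j \<in> I. i \<sqsubseteq> j}"
    proof (cases "f i = 0")
      case True
      then show ?thesis using g[OF i] i leq_refl by (intro image_eqI[of _ _ i]) auto
    next
      case False
      then obtain j where j: "j \<in> strict_points f" "i \<sqsubseteq> j" "f j = f i"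
        using strict_point_above[OF f i] by auto
      then have jI: "j \<in> I" using strict_points_subset by blast
      have "Y j \<notin> Poly_Mapping.keys w" using w j by (auto simp: free_vertices_def)
      moreover have "f j \<le> k" using f jI by (auto simp: antitone_maps_def)
      ultimately have "?g j = f i" using j jI by (simp add: lookup_add lookup_cover_of in_keys_iff)
      then show ?thesis using j jI by (intro image_eqI[of _ _ j]) auto
    qed
  qed
  then show "map_of_cover k (cover_of k f + w) i = f i"
    using i by (simp add: map_of_cover_def)
qed (simp add: map_of_cover_def)

lemma cover_decomposition:
  assumes c: "is_cover k c"
  defines "f \<equiv> map_of_cover k c"
  shows "f \<in> antitone_maps I k \<and> (\<exists>w. c = cover_of k f + w \<and> Poly_Mapping.keys w \<subseteq> free_vertices f)"
proof -
  let ?g = "\<lambda>j. k - Poly_Mapping.lookup c (Y j)"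
  have fin: "finite (?g ` {j \<in> I. i \<sqsubseteq> j})" for i using finite_carrier by simp
  have ne: "?g ` {j \<in> I. i \<sqsubseteq> j} \<noteq> {}" if "i \<in> I" for i using that leq_refl by auto
  have f_eq: "f i = Max (?g ` {j \<in> I. i \<sqsubseteq> j})" if "i \<in> I" for i
    using that by (simp add: f_def map_of_cover_def)
  have attained: "\<exists>j\<in>I. i \<sqsubseteq> j \<and> f i = ?g j" if "i \<in> I" for i
    using Max_in[OF fin ne[OF that]] f_eq[OF that] by auto
  have g_le: "?g j \<le> f i" if "i \<in> I" "j \<in> I" "i \<sqsubseteq> j" for i j
    unfolding f_eq[OF that(1)] by (rule Max_ge[OF fin]) (use that in auto)
  have f: "f \<in> antitone_maps I k"
    unfolding antitone_maps_def
  proof (intro CollectI conjI ballI impI)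
    show "f \<in> I \<rightarrow>\<^sub>E {..k}"
    proof (rule PiE_I)
      fix i assume "i \<in> I"
      then show "f i \<in> {..k}" using attained[of i] by auto
    qed (simp add: f_def map_of_cover_def)
    fix i j assume ij: "i \<in> I" "j \<in> I" "i \<sqsubseteq> j"
    then obtain l where "l \<in> I" "j \<sqsubseteq> l" "f j = ?g l" using attained by blast
    then show "f j \<le> f i" using ij g_le[of i l] leq_trans[of i j l] by simp
  qed
  define w where "w = c - cover_of k f"
  have "Poly_Mapping.lookup (cover_of k f) v \<le> Poly_Mapping.lookup c v" for v
  proof (cases v)
    case (X i)
    show ?thesis
    proof (cases "i \<in> I")
      case True
      then obtain j where "j \<in> I" "i \<sqsubseteq> j" "f i = ?g j" using attained by blast
      then show ?thesis using c True by (simp add: X lookup_cover_of is_cover_def le_diff_conv)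
    qed (simp add: X lookup_cover_of)
  next
    case (Y i)
    then show ?thesis using g_le[of i i] leq_refl by (auto simp: lookup_cover_of)
  qed
  then have c_eq: "c = cover_of k f + w"
    by (intro poly_mapping_eqI) (simp add: w_def lookup_add lookup_minus)
  have "Poly_Mapping.keys w \<subseteq> free_vertices f"
  proof
    fix v assume v: "v \<in> Poly_Mapping.keys w"
    then have "v \<in> Poly_Mapping.keys c" by (auto simp: w_def in_keys_iff lookup_minus)
    then consider i where "v = X i" "i \<in> I" | i where "v = Y i" "i \<in> I"
      using c by (auto simp: is_cover_def)
    then show "v \<in> free_vertices f"
    proof cases
      case (2 i)
      have "i \<notin> strict_points f"
      proof
        assume i: "i \<in> strict_points f"
        \<comment> \<open>If \<open>Y i\<close> had an excess at a strict \<open>i\<close>, the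
          value \<open>f i\<close> could be attained neither at \<open>i\<close> itself nor, by
          strictness, at any other \<open>j\<close>.\<close>
        obtain j where j: "j \<in> I" "i \<sqsubseteq> j" "f i = ?g j" using attained 2 by blast
        have "f i \<le> f j" using g_le[of j j] j leq_refl by simp
        then have "j = i" using i j by (force simp: strict_points_def)
        moreover have "k - f i < Poly_Mapping.lookup c (Y i)"
          using v 2 by (simp add: w_def in_keys_iff lookup_minus lookup_cover_of)
        moreover have "0 < f i" using i by (simp add: strict_points_def)
        ultimately show False using j by simp
      qed
      then show ?thesis using 2 by (simp add: free_vertices_def)
    qed (simp add: free_vertices_def)
  qed
  then show ?thesis using f c_eq by blast
qed

text \<open>\<open>map_of_cover\<close> sorts the covers into disjoint classes by their map; within
  a class the excess ranges freely over the free vertices, with total \<open>e\<close>.\<close>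

lemma card_covers_of_sum:
  "card {c. is_cover k c \<and> (\<Sum>v\<in>X ` I \<union> Y ` I. Poly_Mapping.lookup c v) = card I * k + e} =
    (\<Sum>f\<in>antitone_maps I k. card (vectors_of_sum (free_vertices f) e))"
    (is "card ?C = _")
proof -
  let ?D = "\<lambda>f. (+) (cover_of k f) ` vectors_of_sum (free_vertices f) e"
  have "?C = (\<Union>f\<in>antitone_maps I k. ?D f)"
  proof (intro equalityI subsetI)
    fix c assume c: "c \<in> ?C"
    then obtain f w where fw: "f \<in> antitone_maps I k" "c = cover_of k f + w"
      "Poly_Mapping.keys w \<subseteq> free_vertices f"
      using cover_decomposition by blast
    then have "w \<in> vectors_of_sum (free_vertices f) e"
      using c sum_cover_of_add[OF fw(1,3)] by (simp add: vectors_of_sum_def)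
    then show "c \<in> (\<Union>f\<in>antitone_maps I k. ?D f)" using fw by blast
  next
    fix c assume "c \<in> (\<Union>f\<in>antitone_maps I k. ?D f)"
    then obtain f w where "f \<in> antitone_maps I k" "c = cover_of k f + w"
      "w \<in> vectors_of_sum (free_vertices f) e"
      by blast
    then show "c \<in> ?C"
      using is_cover_cover_of_add[of f k w] sum_cover_of_add[of f k w]
      by (simp add: vectors_of_sum_def)
  qed
  moreover have "card (\<Union>f\<in>antitone_maps I k. ?D f) = (\<Sum>f\<in>antitone_maps I k. card (?D f))"
  proof (rule card_UN_disjoint)
    show "\<forall>f\<in>antitone_maps I k. \<forall>g\<in>antitone_maps I k. f \<noteq> g \<longrightarrow> ?D f \<inter> ?D g = {}"
    proof (intro ballI impI equals0I)
      fix f g c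
      assume fg: "f \<in> antitone_maps I k" "g \<in> antitone_maps I k" "f \<noteq> g" and c: "c \<in> ?D f \<inter> ?D g"
      have "map_of_cover k c = f" "map_of_cover k c = g"
        using c fg map_of_cover_cover_of_add by (auto simp: vectors_of_sum_def)
      then show False using fg by simp
    qed
  qed (use finite_carrier finite_free_vertices in \<open>auto intro: finite_antitone_maps finite_vectors_of_sum\<close>)
  moreover have "card (?D f) = card (vectors_of_sum (free_vertices f) e)" for f
    by (intro card_image) simp
  ultimately show ?thesis by simp
qed

section \<open>Generating function of all covers\<close>

text \<open>The covers with map \<open>f\<close> contribute the series of a polynomial ring in the
  free vertices, leaving one factor \<open>1 - z\<close> per strict point. Then
  \<open>sum_power_strict_points\<close> is applied with \<open>q = 1 - z\<close>, so that
  \<open>1 - q = z\<close>.\<close>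

lemma covers_fps:
  "Abs_fps (\<lambda>e. int (card {c. is_cover k c \<and>
      (\<Sum>v\<in>X ` I \<union> Y ` I. Poly_Mapping.lookup c v) = card I * k + e})) * (1 - fps_X) ^ (2 * card I) =
    (\<Sum>F\<in>Pow I. fps_X ^ (card I - card F) * (1 - fps_X) ^ card F *
      fps_const (int (card (antitone_maps F k))))"
    (is "?L * _ = _")
proof -
  have L: "?L = (\<Sum>f\<in>antitone_maps I k. Abs_fps (\<lambda>e. int (card (vectors_of_sum (free_vertices f) e))))"
    by (rule fps_ext) (simp add: card_covers_of_sum fps_sum_nth)
  have "?L * (1 - fps_X) ^ (2 * card I) =
      (\<Sum>f\<in>antitone_maps I k. (1 - fps_X) ^ card (strict_points f))"
    unfolding L sum_distrib_right
  proof (rule sum.cong)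
    fix f
    show "Abs_fps (\<lambda>e. int (card (vectors_of_sum (free_vertices f) e))) * (1 - fps_X) ^ (2 * card I) =
        (1 - fps_X) ^ card (strict_points f)"
      unfolding card_free_vertices[of f, symmetric] power_add mult.assoc[symmetric]
        vectors_of_sum_fps[OF finite_free_vertices] by simp
  qed simp
  then show ?thesis
    unfolding sum_power_strict_points by (simp add: fps_of_nat)
qed

lemma shifted_sum_covers_fps:
  "shifted_sum (\<lambda>k. Abs_fps (\<lambda>e. int (card {c. is_cover k c \<and>
      (\<Sum>v\<in>X ` I \<union> Y ` I. Poly_Mapping.lookup c v) = card I * k + e}))) * (1 - fps_X) ^ (2 * card I + 1) =
    (\<Sum>F\<in>Pow I. \<Sum>w\<in>linexts F. fps_X ^ (card I - card F + descents w))"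
    (is "shifted_sum ?N * _ = _")
proof -
  have "shifted_sum ?N * (1 - fps_X) ^ (2 * card I) =
      (\<Sum>F\<in>Pow I. shifted_sum (\<lambda>k. fps_X ^ (card I - card F) * (1 - fps_X) ^ card F *
        fps_const (int (card (antitone_maps F k)))))"
    unfolding shifted_sum_mult covers_fps shifted_sum_sum ..
  also have "\<dots> = (\<Sum>F\<in>Pow I. fps_X ^ (card I - card F) * ((1 - fps_X) ^ card F *
      Abs_fps (\<lambda>k. int (card (antitone_maps F k)))))"
  proof (rule sum.cong)
    fix F
    have "shifted_sum (\<lambda>k. fps_const (int (card (antitone_maps F k))) *
        (fps_X ^ (card I - card F) * (1 - fps_X) ^ card F)) =
        Abs_fps (\<lambda>k. int (card (antitone_maps F k))) *
        (fps_X ^ (card I - card F) * (1 - fps_X) ^ card F)"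
      unfolding shifted_sum_mult[symmetric] shifted_sum_const ..
    then show "shifted_sum (\<lambda>k. fps_X ^ (card I - card F) * (1 - fps_X) ^ card F *
        fps_const (int (card (antitone_maps F k)))) =
        fps_X ^ (card I - card F) * ((1 - fps_X) ^ card F *
        Abs_fps (\<lambda>k. int (card (antitone_maps F k))))"
      by (simp only: mult.commute mult.left_commute mult.assoc)
  qed simp
  \<comment> \<open>The last factor \<open>1 - z\<close> of the power \<open>2 * card I + 1\<close>
    joins \<open>(1 - z)^card F\<close> to give the exponent \<open>Suc (card F)\<close> of
    \<open>antitone_maps_fps\<close>.\<close>
  finally have "shifted_sum ?N * (1 - fps_X) ^ (2 * card I + 1) =
      (\<Sum>F\<in>Pow I. fps_X ^ (card I - card F) *
        (Abs_fps (\<lambda>k. int (card (antitone_maps F k))) * (1 - fps_X) ^ Suc (card F)))"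
    by (simp only: power_add power_one_right mult.assoc[symmetric] sum_distrib_right power_Suc2)
      (simp only: mult_ac)
  also have "\<dots> = (\<Sum>F\<in>Pow I. fps_X ^ (card I - card F) * (\<Sum>w\<in>linexts F. fps_X ^ descents w))"
    by (intro sum.cong refl) (simp only: antitone_maps_fps Pow_iff)
  finally show ?thesis by (simp add: sum_distrib_left power_add)
qed

text \<open>The edges between \<open>X i\<close> and \<open>Y i\<close>, present by reflexivity,
  require \<open>k\<close> each. The excess \<open>e\<close> is therefore a natural number.\<close>

lemma card_mult_le_sum_cover:
  assumes "is_cover k c"
  shows "card I * k \<le> (\<Sum>v\<in>X ` I \<union> Y ` I. Poly_Mapping.lookup c v)"
proof -
  have "card I * k = (\<Sum>i\<in>I. k)" by simp
  also have "\<dots> \<le> (\<Sum>i\<in>I. Poly_Mapping.lookup c (X i) + Poly_Mapping.lookup c (Y i))"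
    using assms leq_refl by (intro sum_mono) (auto simp: is_cover_def)
  finally show ?thesis by (simp add: sum_vertices finite_carrier sum.distrib)
qed

lemma finite_covers_of_sum:
  "finite {c. is_cover k c \<and> (\<Sum>v\<in>X ` I \<union> Y ` I. Poly_Mapping.lookup c v) = e}"
  by (rule finite_subset[OF _ finite_vectors_of_sum[of "X ` I \<union> Y ` I" e]])
    (use finite_carrier in \<open>auto simp: is_cover_def vectors_of_sum_def\<close>)

end


section \<open>Linear extensions as words\<close>

lemma descents_map:
  assumes "strict_mono_on (set w) g"
  shows "descents (map g w) = descents w"
proof -
  have "w ! Suc k < w ! k \<longleftrightarrow> g (w ! Suc k) < g (w ! k)" if "Suc k < length w" for k
    using strict_mono_on_less[OF assms, of "w ! Suc k" "w ! k"] that by simp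
  then show ?thesis
    unfolding descents_def length_map by (intro arg_cong[of _ _ card]) auto
qed

lemma (in natural_poset) bij_betw_linexts:
  assumes F: "F \<subseteq> I" and inj: "inj_on p I"
    and le: "\<And>i j. i \<in> I \<Longrightarrow> j \<in> I \<Longrightarrow> i \<sqsubseteq> j \<longleftrightarrow> (p i, p j) \<in> r"
  shows "bij_betw (map p) (linexts F) (linear_extensions (p ` F) r)"
proof (rule bij_betw_imageI)
  have injF: "inj_on p F" using inj F inj_on_subset by blast
  show "inj_on (map p) (linexts F)"
    using injF by (auto simp: inj_on_def linexts_def intro: map_inj_on)
  show "map p ` linexts F = linear_extensions (p ` F) r"
  proof (intro equalityI subsetI)
    fix xs assume "xs \<in> map p ` linexts F"
    then obtain w where xs: "xs = map p w"
      and w: "distinct w" "set w = F" "sorted_wrt (\<lambda>i j. \<not> j \<sqsubseteq> i) w"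
      by (auto simp: linexts_def)
    have "a < b" if ab: "a < length w" "b < length w" "(p (w ! a), p (w ! b)) \<in> r"
      "p (w ! a) \<noteq> p (w ! b)" for a b
    proof -
      have "w ! a \<in> I" "w ! b \<in> I" using ab w(2) F by auto
      then have "w ! a \<sqsubseteq> w ! b" using ab le by simp
      then show ?thesis
        using ab w(3) by (metis linorder_neqE_nat sorted_wrt_iff_nth_less)
    qed
    then show "xs \<in> linear_extensions (p ` F) r"
      using w injF by (simp add: linear_extensions_def xs distinct_map)
  next
    fix xs assume "xs \<in> linear_extensions (p ` F) r"
    then have xs: "distinct xs" "set xs = p ` F"
      and lin: "\<And>a b. a < length xs \<Longrightarrow> b < length xs \<Longrightarrow> (xs ! a, xs ! b) \<in> r \<Longrightarrow>
        xs ! a \<noteq> xs ! b \<Longrightarrow> a < b"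
      by (auto simp: linear_extensions_def)
    define w where "w = map (inv_into F p) xs"
    have xs_eq: "map p w = xs"
      unfolding w_def map_map by (rule map_idI) (use xs in \<open>simp add: f_inv_into_f\<close>)
    have "distinct w" using xs by (simp add: w_def distinct_map inj_on_inv_into)
    moreover have setw: "set w = F"
      unfolding w_def set_map xs(2) using injF by (rule inv_into_image_cancel) simp
    moreover have "sorted_wrt (\<lambda>i j. \<not> j \<sqsubseteq> i) w"
      unfolding sorted_wrt_iff_nth_less
    proof (intro allI impI notI)
      fix a b assume ab: "a < b" "b < length w" "w ! b \<sqsubseteq> w ! a"
      then have len: "a < length xs" "b < length xs" by (auto simp: w_def)
      have "w ! a \<in> I" "w ! b \<in> I" using ab setw F by auto
      then have "(p (w ! b), p (w ! a)) \<in> r" using le ab(3) by blast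
      then have "(xs ! b, xs ! a) \<in> r" using ab by (simp flip: xs_eq)
      moreover have "xs ! b \<noteq> xs ! a" using xs(1) len ab(1) by (simp add: nth_eq_iff_index_eq)
      ultimately show False using lin[of b a] len ab(1) by simp
    qed
    ultimately show "xs \<in> map p ` linexts F"
      using xs_eq by (intro image_eqI[of _ _ w]) (auto simp: linexts_def)
  qed
qed

text \<open>Replacing the indices in \<open>F\<close> by their ranks is strictly increasing and
  keeps the descents, so they can be read off from the word of indices.\<close>

lemma (in natural_poset) card_linear_extensions:
  assumes F: "F \<subseteq> I" and inj: "inj_on p I"
    and le: "\<And>i j. i \<in> I \<Longrightarrow> j \<in> I \<Longrightarrow> i \<sqsubseteq> j \<longleftrightarrow> (p i, p j) \<in> r"
  shows "card {xs \<in> linear_extensions (p ` F) r. descents (word_of p F xs) = m} =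
    card {w \<in> linexts F. descents w = m}"
proof -
  have bij: "bij_betw (map p) (linexts F) (linear_extensions (p ` F) r)"
    using bij_betw_linexts[OF F inj le] .
  have "descents (word_of p F (map p w)) = descents w" if w: "w \<in> linexts F" for w
  proof -
    have setw: "set w = F" using w by (simp add: linexts_def)
    have "inv_into F p (p i) = i" if "i \<in> F" for i
      using that inj F inj_on_subset by (metis inv_into_f_f)
    then have "word_of p F (map p w) = map (\<lambda>i. card {j \<in> F. j \<le> i}) w"
      by (simp add: word_of_def setw)
    moreover have "strict_mono_on (set w) (\<lambda>i. card {j \<in> F. j \<le> i})"
    proof (rule strict_mono_onI)
      fix i j assume "i \<in> set w" "j \<in> set w" "i < j"
      then have "{l \<in> F. l \<le> i} \<subseteq> {l \<in> F. l \<le> j}" "j \<in> {l \<in> F. l \<le> j} - {l \<in> F. l \<le> i}"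
        using setw by auto
      then show "card {l \<in> F. l \<le> i} < card {l \<in> F. l \<le> j}"
        using finite_below[OF F] by (intro psubset_card_mono) auto
    qed
    ultimately show ?thesis by (simp add: descents_map)
  qed
  then have "bij_betw (map p) {w \<in> linexts F. descents w = m}
      {xs \<in> linear_extensions (p ` F) r. descents (word_of p F xs) = m}"
    by (intro bij_betw_Collect[OF bij]) simp
  then show ?thesis by (simp add: bij_betw_same_card)
qed

section \<open>Hilbert series of the algebra and its h-vector\<close>

lemma (in natural_poset) hilbert_series_poset_graph:
  fixes p :: "nat \<Rightarrow> 'a"
  assumes I: "I = {1..n}" and P: "partial_order_on P r" "bij_betw p {1..n} P"
    and le: "\<And>i j. i \<in> I \<Longrightarrow> j \<in> I \<Longrightarrow> i \<sqsubseteq> j \<longleftrightarrow> (p i, p j) \<in> r"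
  shows "hilbert_series (vertex_cover_algebra (poset_graph n p r))
      (degree_one_generators (poset_graph n p r) :: (vertex, 'k::field) mpoly poly set) =
    shifted_sum (\<lambda>k. Abs_fps (\<lambda>e. int (card {c. is_cover k c \<and>
      (\<Sum>v\<in>X ` I \<union> Y ` I. Poly_Mapping.lookup c v) = card I * k + e})))"
proof (rule fps_ext)
  fix d
  let ?G = "poset_graph n p r"
  let ?sum = "\<lambda>c. \<Sum>v\<in>X ` I \<union> Y ` I. Poly_Mapping.lookup c v"
  let ?C = "\<lambda>k. {c. is_cover k c \<and> ?sum c = card I * k + (d - k)}"
  have cover: "k_vertex_cover ?G k c \<longleftrightarrow> is_cover k c" for k c
  proof -
    have "fst ?G = X ` I \<union> Y ` I" by (simp add: poset_graph_def I)
    moreover have "{v, w} \<in> snd ?G \<longleftrightarrow>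
        (\<exists>i\<in>I. \<exists>j\<in>I. i \<sqsubseteq> j \<and> (v = X i \<and> w = Y j \<or> v = Y j \<and> w = X i))" for v w
      unfolding doubleton_poset_graph I[symmetric] using le by blast
    ultimately show ?thesis
      by (auto simp: k_vertex_cover_def is_cover_def add.commute)
  qed
  \<comment> \<open>The weight of a cover monomial is the sum of its exponents minus
    \<open>(n - 1) * k\<close>, so an excess \<open>e\<close> over \<open>n * k\<close> means degree
    \<open>k + e\<close>.\<close>
  have weight: "wt n c k = int d \<longleftrightarrow> ?sum c + k = card I * k + d" for c k
  proof -
    have "wt n c k = int (?sum c) + (1 - int (card I)) * int k"
      unfolding wt_def I[symmetric] by (simp add: I)
    also have "\<dots> = int (?sum c + k) - int (card I * k)"
      by (simp add: algebra_simps)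
    finally show ?thesis by linarith
  qed
  \<comment> \<open>The excess is nonnegative, so \<open>k \<le> d\<close> and the truncated
    \<open>d - k\<close> is a true difference.\<close>
  have "wt n c k = int d \<longleftrightarrow> k \<le> d \<and> ?sum c = card I * k + (d - k)" if "is_cover k c" for c k
    unfolding weight using card_mult_le_sum_cover[OF that] by linarith
  then have "{(c, k). k_vertex_cover ?G k c \<and> wt n c k = int d} = prod.swap ` (SIGMA k:{..d}. ?C k)"
    unfolding cover by (auto simp: image_iff)
  then have "card {(c, k). k_vertex_cover ?G k c \<and> wt n c k = int d} = card (SIGMA k:{..d}. ?C k)"
    by (simp add: card_image)
  also have "\<dots> = (\<Sum>k\<le>d. card (?C k))"
    by (rule card_SigmaI) (auto intro: finite_covers_of_sum)
  finally show "fps_nth (hilbert_series (vertex_cover_algebra ?G)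
      (degree_one_generators ?G :: (vertex, 'k::field) mpoly poly set)) d =
    fps_nth (shifted_sum (\<lambda>k. Abs_fps (\<lambda>e. int (card {c. is_cover k c \<and>
      ?sum c = card I * k + e})))) d"
    using dim_graded_component[OF P, where ?'k = 'k, of d]
    by (simp add: hilbert_series_def shifted_sum_def)
qed

text \<open>The subsets are grouped by the number \<open>l\<close> of omitted elements, which shifts
  the descent count by \<open>l\<close>; those with \<open>l > j\<close> do not reach this
  coefficient.\<close>

lemma (in natural_poset) coeff_sum_linexts:
  assumes "j \<le> card I"
  shows "fps_nth (\<Sum>F\<in>Pow I. \<Sum>w\<in>linexts F. fps_X ^ (card I - card F + descents w)) j =
    int (\<Sum>l=0..j. \<Sum>F | F \<subseteq> I \<and> card F = card I - l. card {w \<in> linexts F. descents w = j - l})"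
proof -
  let ?c = "\<lambda>F. int (card {w \<in> linexts F. card I - card F + descents w = j})"
  have "fps_nth (\<Sum>F\<in>Pow I. \<Sum>w\<in>linexts F. fps_X ^ (card I - card F + descents w)) j =
      (\<Sum>F\<in>Pow I. ?c F)"
    unfolding fps_sum_nth
  proof (rule sum.cong)
    fix F assume "F \<in> Pow I"
    then have "finite (linexts F)" by (intro finite_linexts finite_below) simp
    then show "(\<Sum>w\<in>linexts F. fps_nth (fps_X ^ (card I - card F + descents w)) j) = ?c F"
      by (simp add: fps_X_power_nth eq_commute[of j] flip: sum.inter_filter)
  qed simp
  also have "\<dots> = (\<Sum>F\<in>{F \<in> Pow I. card I - card F \<le> j}. ?c F)"
  proof (rule sum.mono_neutral_right)
    show "\<forall>F\<in>Pow I - {F \<in> Pow I. card I - card F \<le> j}. ?c F = 0"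
    proof
      fix F assume "F \<in> Pow I - {F \<in> Pow I. card I - card F \<le> j}"
      then have "{w \<in> linexts F. card I - card F + descents w = j} = {}" by auto
      then show "?c F = 0" by (simp only: card.empty of_nat_0)
    qed
  qed (use finite_carrier in auto)
  also have "\<dots> = (\<Sum>l=0..j. \<Sum>F\<in>{F \<in> {F \<in> Pow I. card I - card F \<le> j}. card I - card F = l}. ?c F)"
    using finite_carrier by (intro sum.group[symmetric]) auto
  also have "\<dots> = (\<Sum>l=0..j. \<Sum>F | F \<subseteq> I \<and> card F = card I - l.
      int (card {w \<in> linexts F. descents w = j - l}))"
  proof (intro sum.cong)
    fix l assume l: "l \<in> {0..j}"
    \<comment> \<open>Because \<open>l \<le> j \<le> card I\<close>, neither
      \<open>card I - card F\<close> nor \<open>card I - l\<close> is truncated, so the two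
      conditions on \<open>card F\<close> agree.\<close>
    have le: "card F \<le> card I" if "F \<subseteq> I" for F
      using card_mono[OF finite_carrier that] .
    show "{F \<in> {F \<in> Pow I. card I - card F \<le> j}. card I - card F = l} =
        {F. F \<subseteq> I \<and> card F = card I - l}"
    proof (intro Collect_cong)
      fix F
      show "F \<in> {F \<in> Pow I. card I - card F \<le> j} \<and> card I - card F = l \<longleftrightarrow>
          F \<subseteq> I \<and> card F = card I - l"
        using le[of F] l assms by (cases "F \<subseteq> I") auto
    qed
    fix F assume "F \<in> {F. F \<subseteq> I \<and> card F = card I - l}"
    then have "card I - card F = l" using l assms by simp
    then have "{w \<in> linexts F. card I - card F + descents w = j} = {w \<in> linexts F. descents w = j - l}"
      using l by auto
    then show "?c F = int (card {w \<in> linexts F. descents w = j - l})" by simp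
  qed simp
  finally show ?thesis by simp
qed

theorem corollary3p5:
  fixes n j :: nat
    and P :: "'a set" and r :: "'a rel" and p :: "nat \<Rightarrow> 'a"
    and A E :: "(vertex, 'k::field) mpoly poly set"
  assumes "n \<ge> 1"
    and "partial_order_on P r"
    and "bij_betw p {1..n} P"
    and "\<And>i k. i \<in> {1..n} \<Longrightarrow> k \<in> {1..n} \<Longrightarrow> (p i, p k) \<in> r \<Longrightarrow> i \<le> k"
    and "A = vertex_cover_algebra (poset_graph n p r)"
    and "E = degree_one_generators (poset_graph n p r)"
    and "j \<le> n - 1"
  shows "h_vector A E (2 * n + 1) j =
    int (\<Sum>l=0..j. \<Sum>F | F \<subseteq> {1..n} \<and> card F = n - l.
      card {xs \<in> linear_extensions (p ` F) r. descents (word_of p F xs) = j - l})"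
proof -
  define I where "I = {1..n}"
  have n: "n = card I" and inj: "inj_on p I"
    using assms(3) by (simp_all add: I_def bij_betw_def)
  interpret natural_poset I "\<lambda>i j. (p i, p j) \<in> r"
  proof
    show "finite I" by (simp add: I_def)
    show "(p i, p i) \<in> r" if "i \<in> I" for i
      using assms(2) bij_betwE[OF assms(3)] that
      by (auto simp: I_def partial_order_on_def preorder_on_def refl_on_def)
    show "(p i, p k) \<in> r" if "(p i, p j) \<in> r" "(p j, p k) \<in> r" for i j k
      using assms(2) that unfolding partial_order_on_def preorder_on_def by (meson transD)
    show "i \<le> k" if "i \<in> I" "k \<in> I" "(p i, p k) \<in> r" for i k
      using that unfolding I_def by (rule assms(4))
  qed
  have "hilbert_series A E = shifted_sum (\<lambda>k. Abs_fps (\<lambda>e. int (card {c. is_cover k c \<and>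
      (\<Sum>v\<in>X ` I \<union> Y ` I. Poly_Mapping.lookup c v) = card I * k + e})))"
    unfolding assms(5,6) by (rule hilbert_series_poset_graph[OF I_def assms(2,3)]) simp
  then have "h_vector A E (2 * n + 1) j =
      fps_nth (\<Sum>F\<in>Pow I. \<Sum>w\<in>linexts F. fps_X ^ (n - card F + descents w)) j"
    using shifted_sum_covers_fps by (simp only: h_vector_def n)
  also have "\<dots> = int (\<Sum>l=0..j. \<Sum>F | F \<subseteq> I \<and> card F = n - l.
      card {w \<in> linexts F. descents w = j - l})"
    by (rule coeff_sum_linexts[folded n]) (use assms(7) in simp)
  also have "\<dots> = int (\<Sum>l=0..j. \<Sum>F | F \<subseteq> I \<and> card F = n - l.
      card {xs \<in> linear_extensions (p ` F) r. descents (word_of p F xs) = j - l})"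
    by (intro arg_cong[of _ _ int] sum.cong refl card_linear_extensions[symmetric] inj) auto
  finally show ?thesis unfolding I_def .
qed

end
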